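(* Let $\lambda\supseteq\mu$ be partitions and $N=|\lambda/\mu|$. For each right snake $S$ of $\lambda/\mu$ fix a set $F_S$ of $\ell(S)/2$ links of $S$, no two consecutive, and let $F=\bigcup_S F_S$. Let $Q_F$ be the set of all minimal border strip decompositions of $\lambda/\mu$ that use every link in $F$. Then for each $\sigma\vdash N$, $Q_F$ contains exactly $\mathrm{is}_\sigma(\lambda/\mu)$ minimal border strip decompositions of type $\sigma$.
   Context: Skew diagram $\lambda/\mu=\{(i,j):\mu_i<j\le\lambda_i\}$; square $(i,j)$ drawn as $[j-1,j]\times[-i,-i+1]$. $r=\mathrm{rank}(\lambda/\mu)$: an outside top corner is $(i,j)\in\lambda/\mu$ with $(i-1,j),(i,j-1)\notin\lambda/\mu$; an inside top corner is $(i,j)\in\lambda/\mu$ with $(i-1,j),(i,j-1)\in\lambda/\mu$, $(i-1,j-1)\notin\lambda/\mu$; the diagonal of corner $(i,j)$ is $\{(i+p,j+p)\in\lambda/\mu:p\ge0\}$; rank = number of squares on outside diagonals minus number on inside diagonals. A border strip is a nonempty edge-connected skew diagram with no $2\times2$ block; a border strip decomposition is a partition of the squares of $\lambda/\mu$ into border strips, minimal if it has the fewest strips; its type is the partition of $N$ given by the strip sizes. Snakes: for a partition $\alpha$, its boundary path goes up $x=0$ from $y=-\infty$ to $(0,-\ell(\alpha))$, follows the lower-right boundary of $\alpha$ to $(\alpha_1,0)$, then right along $y=0$; the step starting at $(x,y)$ has index $x+y$. For $k\in\mathbb{Z}$ let $e_k$ be step $k$ of the path of $\lambda$. If $e_k$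 is also a step of the path of $\mu$, $S_k=\emptyset$. Otherwise, if $e_k$ is horizontal it is the lower edge of $(i,j)\in\lambda/\mu$ and $S_k=(\lambda/\mu)\cap\{(i,j),(i,j-1),(i-1,j-1),(i-1,j-2),\dots\}$; if vertical it is the right edge of $(i,j)\in\lambda/\mu$ and $S_k=(\lambda/\mu)\cap\{(i,j),(i-1,j),(i-1,j-1),(i-2,j-1),\dots\}$. $\ell(S_k)=|S_k|-1$. $S_k$ is a left snake if $e_k$ horizontal and $\ell(S_k)\ge0$ even; a right snake if $e_k$ vertical and $\ell(S_k)\ge0$ even. A link of a snake is a pair of its squares sharing an edge; two links are consecutive if they share a square; a border strip decomposition uses a link if some strip contains both of its squares. An interval set is a set $\{(u_1,v_1),\dots,(u_r,v_r)\}$ of pairs of integers, the $2r$ integers distinct, $u_i<v_i$, each $S_{u_i}$ a left snake and each $S_{v_i}$ a right snake; its type is the partition with parts $v_i-u_i$. $\mathrm{is}_\sigma(\lambda/\mu)$ is the number of interval sets of type $\sigma$. *)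

theory Defs
  imports Main "HOL-Library.Multiset" "HOL-Library.Disjoint_Sets"
begin

text \<open>A square is a pair (row, column), in matrix coordinates starting at 1. Integers are used
  so that shifts such as (i - 1, j - 1) never truncate.\<close>

type_synonym square = "int \<times> int"

definition is_partition :: "nat list \<Rightarrow> bool" where
  "is_partition \<alpha> \<longleftrightarrow> sorted_wrt (\<ge>) \<alpha> \<and> 0 \<notin> set \<alpha>"

definition is_partition_of :: "nat list \<Rightarrow> nat \<Rightarrow> bool" (infix "partitions" 50) where
  "\<alpha> partitions n \<longleftrightarrow> is_partition \<alpha> \<and> sum_list \<alpha> = n"

text \<open>The i-th part, for i counted from 1; it is 0 beyond the length.\<close>

definition part :: "nat list \<Rightarrow> int \<Rightarrow> int" where
  "part \<alpha> i = (if 1 \<le> i \<and> i \<le> int (length \<alpha>) then int (\<alpha> ! nat (i - 1)) else 0)"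

definition partition_contains :: "nat list \<Rightarrow> nat list \<Rightarrow> bool" where
  "partition_contains \<alpha> \<beta> \<longleftrightarrow> (\<forall>i. part \<beta> i \<le> part \<alpha> i)"

definition skew :: "nat list \<Rightarrow> nat list \<Rightarrow> square set" where
  "skew \<alpha> \<beta> = {(i, j). 1 \<le> i \<and> part \<beta> i < j \<and> j \<le> part \<alpha> i}"

definition is_skew_diagram :: "square set \<Rightarrow> bool" where
  "is_skew_diagram S \<longleftrightarrow>
     (\<exists>\<alpha> \<beta>. is_partition \<alpha> \<and> is_partition \<beta> \<and> partition_contains \<alpha> \<beta> \<and> S = skew \<alpha> \<beta>)"

definition partition_of_parts :: "nat multiset \<Rightarrow> nat list" where
  "partition_of_parts M = rev (sorted_list_of_multiset M)"

definition outside_top_corners :: "square set \<Rightarrow> square set" where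
  "outside_top_corners S = {(i, j) \<in> S. (i - 1, j) \<notin> S \<and> (i, j - 1) \<notin> S}"

definition inside_top_corners :: "square set \<Rightarrow> square set" where
  "inside_top_corners S =
     {(i, j) \<in> S. (i - 1, j) \<in> S \<and> (i, j - 1) \<in> S \<and> (i - 1, j - 1) \<notin> S}"

definition diagonal :: "square set \<Rightarrow> square \<Rightarrow> square set" where
  "diagonal S c = S \<inter> range (\<lambda>p::nat. (fst c + int p, snd c + int p))"

text \<open>Distinct corners have disjoint diagonals, so counting squares in the unions agrees with
  summing the lengths of the diagonals.\<close>

definition rank :: "square set \<Rightarrow> int" where
  "rank S = int (card (\<Union>c \<in> outside_top_corners S. diagonal S c))
          - int (card (\<Union>c \<in> inside_top_corners S. diagonal S c))"

definition share_edge :: "square \<Rightarrow> square \<Rightarrow> bool" where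
  "share_edge a b \<longleftrightarrow> \<bar>fst a - fst b\<bar> + \<bar>snd a - snd b\<bar> = 1"

definition edge_connected :: "square set \<Rightarrow> bool" where
  "edge_connected S \<longleftrightarrow>
     (\<forall>a\<in>S. \<forall>b\<in>S. (a, b) \<in> {(c, d). c \<in> S \<and> d \<in> S \<and> share_edge c d}\<^sup>*)"

definition border_strip :: "square set \<Rightarrow> bool" where
  "border_strip B \<longleftrightarrow>
     is_skew_diagram B \<and> B \<noteq> {} \<and> edge_connected B \<and>
     (\<nexists>i j. {(i, j), (i, j + 1), (i + 1, j), (i + 1, j + 1)} \<subseteq> B)"

definition bs_decomposition :: "square set \<Rightarrow> square set set \<Rightarrow> bool" where
  "bs_decomposition S D \<longleftrightarrow> partition_on S D \<and> (\<forall>B\<in>D. border_strip B)"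

definition minimal_bs_decomposition :: "square set \<Rightarrow> square set set \<Rightarrow> bool" where
  "minimal_bs_decomposition S D \<longleftrightarrow>
     bs_decomposition S D \<and> (\<forall>D'. bs_decomposition S D' \<longrightarrow> card D \<le> card D')"

definition bs_type :: "square set set \<Rightarrow> nat list" where
  "bs_type D = partition_of_parts (image_mset card (mset_set D))"

text \<open>Steps of lattice paths in the plane, given by their starting point (x, y): a horizontal
  step ends at (x + 1, y), a vertical one at (x, y + 1). Since the square (i, j) is drawn as
  [j - 1, j] times [- i, - i + 1], its lower edge is the step HStep (j - 1) (- i) and its right
  edge is the step VStep j (- i).\<close>

datatype step = HStep int int | VStep int int

fun step_index :: "step \<Rightarrow> int" where
  "step_index (HStep x y) = x + y"
| "step_index (VStep x y) = x + y"

text \<open>At height y = - i with i > 0 the boundary path of a partition consists of the horizontal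
  steps with x from part (i + 1) to part i and of the vertical step at x = part i; at height 0
  it consists of all horizontal steps from x = part 1 on. As parts beyond the length are 0,
  this includes the initial vertical ray x = 0.\<close>

definition boundary_path :: "nat list \<Rightarrow> step set" where
  "boundary_path \<alpha> =
     {HStep x y | x y. y \<le> 0 \<and> part \<alpha> (1 - y) \<le> x \<and> (y < 0 \<longrightarrow> x < part \<alpha> (- y))} \<union>
     {VStep x y | x y. y < 0 \<and> x = part \<alpha> (- y)}"

text \<open>For a partition, every integer is the index of exactly one step of its boundary path, so
  the description below is definite.\<close>

definition path_step :: "nat list \<Rightarrow> int \<Rightarrow> step" where
  "path_step \<alpha> k = (THE e. e \<in> boundary_path \<alpha> \<and> step_index e = k)"

text \<open>The staircases of squares going up and to the left from (i, j), whose first move is to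
  the left, respectively upwards.\<close>

definition left_staircase :: "square \<Rightarrow> square set" where
  "left_staircase s = (case s of (i, j) \<Rightarrow>
     \<Union>p::nat. {(i - int p, j - int p), (i - int p, j - int p - 1)})"

definition up_staircase :: "square \<Rightarrow> square set" where
  "up_staircase s = (case s of (i, j) \<Rightarrow>
     \<Union>p::nat. {(i - int p, j - int p), (i - int p - 1, j - int p)})"

definition snake :: "nat list \<Rightarrow> nat list \<Rightarrow> int \<Rightarrow> square set" where
  "snake lam mu k =
     (if path_step lam k \<in> boundary_path mu then {}
      else case path_step lam k of
        HStep x y \<Rightarrow> skew lam mu \<inter> left_staircase (- y, x + 1)
      | VStep x y \<Rightarrow> skew lam mu \<inter> up_staircase (- y, x))"

text \<open>The length of the empty snake is - 1.\<close>

definition snake_length :: "nat list \<Rightarrow> nat list \<Rightarrow> int \<Rightarrow> int" where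
  "snake_length lam mu k = int (card (snake lam mu k)) - 1"

text \<open>Left and right snakes are identified by their index k, since whether the snake is left or
  right depends on the step and not only on the set of squares. Distinct indices give distinct
  right snakes, and likewise distinct left snakes.\<close>

definition left_snake :: "nat list \<Rightarrow> nat list \<Rightarrow> int \<Rightarrow> bool" where
  "left_snake lam mu k \<longleftrightarrow>
     (\<exists>x y. path_step lam k = HStep x y) \<and> 0 \<le> snake_length lam mu k \<and> even (snake_length lam mu k)"

definition right_snake :: "nat list \<Rightarrow> nat list \<Rightarrow> int \<Rightarrow> bool" where
  "right_snake lam mu k \<longleftrightarrow>
     (\<exists>x y. path_step lam k = VStep x y) \<and> 0 \<le> snake_length lam mu k \<and> even (snake_length lam mu k)"

definition links :: "square set \<Rightarrow> square set set" where
  "links S = {{a, b} | a b. a \<in> S \<and> b \<in> S \<and> share_edge a b}"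

definition consecutive_links :: "square set \<Rightarrow> square set \<Rightarrow> bool" where
  "consecutive_links L L' \<longleftrightarrow> L \<noteq> L' \<and> L \<inter> L' \<noteq> {}"

definition uses_link :: "square set set \<Rightarrow> square set \<Rightarrow> bool" where
  "uses_link D L \<longleftrightarrow> (\<exists>B\<in>D. L \<subseteq> B)"

definition minimal_bs_decompositions_using ::
    "square set \<Rightarrow> square set set \<Rightarrow> square set set set" where
  "minimal_bs_decompositions_using S F =
     {D. minimal_bs_decomposition S D \<and> (\<forall>L\<in>F. uses_link D L)}"

definition interval_set :: "nat list \<Rightarrow> nat list \<Rightarrow> (int \<times> int) set \<Rightarrow> bool" where
  "interval_set lam mu I \<longleftrightarrow>
     finite I \<and> int (card I) = rank (skew lam mu) \<and>
     card (fst ` I \<union> snd ` I) = 2 * card I \<and>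
     (\<forall>(u, v)\<in>I. u < v \<and> left_snake lam mu u \<and> right_snake lam mu v)"

definition interval_type :: "(int \<times> int) set \<Rightarrow> nat list" where
  "interval_type I = partition_of_parts (image_mset (\<lambda>(u, v). nat (v - u)) (mset_set I))"

definition num_interval_sets :: "nat list \<Rightarrow> nat list \<Rightarrow> nat list \<Rightarrow> nat" where
  "num_interval_sets \<sigma> lam mu = card {I. interval_set lam mu I \<and> interval_type I = \<sigma>}"

end

theory Submission
  imports Defs
begin

text \<open>A border strip has one square of each content in an interval of contents, so a border strip
  decomposition amounts to a matching between any two adjacent diagonals of the shape. The squares
  on two adjacent diagonals form a path, namely a snake, and the decomposition is minimal iff all
  these matchings are maximum. A path with an even number of squares has a unique maximum matching;
  in a left or right snake exactly one square stays unmatched, and there a strip starts or ends.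
  The starts and ends of the strips therefore form an interval set.

  If the matchings on the right snakes are prescribed, sweep the contents downwards and label each
  square by the end of its strip. The labels on one diagonal and the interval set determine the
  labels on the next one: at a left snake the interval set says which label disappears, hence which
  square is unmatched, and at a right snake a new label appears at the prescribed place. So each
  interval set comes from exactly one decomposition.\<close>

section \<open>Border strips as ribbons\<close>

text \<open>All that the argument needs of the shape are two integer functions: the diagonal of
  content c consists of the rows i with \<open>m c < i\<close> and \<open>i \<le> l c\<close>, and
  both functions stay or drop by one from c to c + 1. Snakes, rank and matchings become statements
  about first differences of \<open>l\<close> and \<open>m\<close>. A strip with contents u + 1,
  ..., v is recorded as (u, v), because snake k lies on the diagonals k and k + 1; so its size is v
  - u. The direction of the sweep comes from prescribing links on right snakes: going downwards, a
  right snake is the only place where a strip is entered, hence the only place where a row is not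
  forced by the labels already known. At every other snake uniqueness rests on
  \<open>inj_shift_below\<close>: an injection that moves each row by 0 or -1 and misses a known
  value is forced. The number of left snakes characterises minimality only if some decomposition
  attains it, so one interval set has to be exhibited before anything can be counted;
  \<open>pairing_exists\<close> does this.\<close>

definition content :: "square \<Rightarrow> int" where
  "content x = snd x - fst x"

text \<open>The clause on x and y says that a square of non-maximal content has its successor next
  to it, so the set is a walk going right or up. No partitions, connectedness or 2x2 blocks
  remain.\<close>

definition ribbon :: "square set \<Rightarrow> bool" where
  "ribbon B \<longleftrightarrow> finite B \<and> B \<noteq> {} \<and> inj_on content B \<and>
     (\<forall>x\<in>B. \<forall>y\<in>B. content x < content y \<longrightarrow> (\<exists>z\<in>B. content z = content x + 1 \<and> share_edge x z))"

text \<open>Intrinsic characterisation of skew diagrams among finite sets of squares with positive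
  coordinates.\<close>

definition order_convex :: "square set \<Rightarrow> bool" where
  "order_convex B \<longleftrightarrow> (\<forall>i j i' j' a b. (i, j) \<in> B \<longrightarrow> (i', j') \<in> B \<longrightarrow>
     i \<le> a \<longrightarrow> a \<le> i' \<longrightarrow> j \<le> b \<longrightarrow> b \<le> j' \<longrightarrow> (a, b) \<in> B)"

section \<open>Skew diagrams and order-convex sets\<close>

lemma part_nonneg: "0 \<le> part \<alpha> i"
  by (simp add: part_def)

lemma part_antimono:
  assumes "is_partition \<alpha>" "1 \<le> i" "i \<le> i'"
  shows "part \<alpha> i' \<le> part \<alpha> i"
proof (cases "i' \<le> int (length \<alpha>)")
  case True
  have "\<alpha> ! nat (i' - 1) \<le> \<alpha> ! nat (i - 1)"
  proof (cases "i = i'")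
    case False
    then show ?thesis
      using assms True by (intro sorted_wrt_nth_less[of "(\<ge>)"]) (auto simp: is_partition_def)
  qed simp
  then show ?thesis using assms True by (simp add: part_def)
next
  case False
  then show ?thesis by (simp add: part_def)
qed

lemma finite_skew: "finite (skew \<alpha> \<beta>)"
proof -
  have "skew \<alpha> \<beta> \<subseteq> Sigma {1..int (length \<alpha>)} (\<lambda>i. {1..part \<alpha> i})"
  proof
    fix x assume "x \<in> skew \<alpha> \<beta>"
    then obtain i j where x: "x = (i, j)" "1 \<le> i" "part \<beta> i < j" "j \<le> part \<alpha> i"
      by (auto simp: skew_def)
    then have "0 < j" using part_nonneg[of \<beta> i] by simp
    moreover from this x have "i \<le> int (length \<alpha>)"
      by (auto simp: part_def split: if_splits)
    ultimately show "x \<in> Sigma {1..int (length \<alpha>)} (\<lambda>i. {1..part \<alpha> i})"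
      using x by simp
  qed
  then show ?thesis by (rule finite_subset) auto
qed

lemma skew_diagram_finite: "is_skew_diagram B \<Longrightarrow> finite B"
  by (auto simp: is_skew_diagram_def finite_skew)

lemma skew_diagram_order_convex:
  assumes "is_skew_diagram B"
  shows "order_convex B"
proof -
  obtain \<alpha> \<beta> where ab: "is_partition \<alpha>" "is_partition \<beta>" "B = skew \<alpha> \<beta>"
    using assms by (auto simp: is_skew_diagram_def)
  show ?thesis
    unfolding order_convex_def
  proof (intro allI impI)
    fix i j i' j' a b
    assume *: "(i, j) \<in> B" "(i', j') \<in> B" "i \<le> a" "a \<le> i'" "j \<le> b" "b \<le> j'"
    then show "(a, b) \<in> B"
      using part_antimono[OF ab(1), of a i'] part_antimono[OF ab(2), of i a]
      by (auto simp: ab(3) skew_def)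
  qed
qed

lemma partition_of_function:
  fixes f :: "nat \<Rightarrow> nat"
  assumes anti: "\<And>i k. i \<le> k \<Longrightarrow> f k \<le> f i" and zero: "f n = 0"
  shows "\<exists>\<alpha>. is_partition \<alpha> \<and> (\<forall>i. part \<alpha> (int i + 1) = int (f i))"
proof -
  define s where "s = (LEAST n. f n = 0)"
  have s: "f s = 0" unfolding s_def by (rule LeastI[of _ n]) (rule zero)
  have pos: "f i \<noteq> 0" if "i < s" for i
    using not_less_Least[of i "\<lambda>n. f n = 0"] that by (simp add: s_def)
  have s0: "f i = 0" if "s \<le> i" for i using anti[OF that] s by simp
  define \<alpha> where "\<alpha> = map f [0..<s]"
  have "is_partition \<alpha>"
    using pos anti by (force simp: is_partition_def \<alpha>_def sorted_wrt_iff_nth_less)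
  moreover have "part \<alpha> (int i + 1) = int (f i)" for i
    using s0 by (auto simp: part_def \<alpha>_def)
  ultimately show ?thesis by blast
qed

lemma down_closed_int:
  fixes X :: "int set"
  assumes fin: "finite X" and pos: "\<And>i. i \<in> X \<Longrightarrow> 1 \<le> i"
    and down: "\<And>i k. i \<in> X \<Longrightarrow> 1 \<le> k \<Longrightarrow> k \<le> i \<Longrightarrow> k \<in> X"
  shows "X = {1..int (card X)}"
proof (cases "X = {}")
  case False
  then have M: "Max X \<in> X" using fin by simp
  have "X = {1..Max X}"
  proof
    show "X \<subseteq> {1..Max X}" using pos fin by auto
    show "{1..Max X} \<subseteq> X" using down[OF M] by auto
  qed
  moreover have "1 \<le> Max X" using M pos by blast
  ultimately obtain b where "X = {1..b}" "1 \<le> b" by blast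
  then show ?thesis by simp
qed simp

text \<open>A finite order ideal is a Young diagram: each row is an initial segment by
  \<open>down_closed_int\<close>, and the row lengths decrease.\<close>

lemma order_ideal_partition:
  fixes I :: "square set"
  assumes fin: "finite I" and pos: "\<And>i j. (i, j) \<in> I \<Longrightarrow> 1 \<le> i \<and> 1 \<le> j"
    and down: "\<And>i j i' j'. (i, j) \<in> I \<Longrightarrow> 1 \<le> i' \<Longrightarrow> i' \<le> i \<Longrightarrow> 1 \<le> j' \<Longrightarrow> j' \<le> j \<Longrightarrow> (i', j') \<in> I"
  shows "\<exists>\<alpha>. is_partition \<alpha> \<and> (\<forall>i j. 1 \<le> i \<longrightarrow> 1 \<le> j \<longrightarrow> (j \<le> part \<alpha> i \<longleftrightarrow> (i, j) \<in> I))"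
proof -
  define R where "R i = {j. (i, j) \<in> I}" for i
  have finR: "finite (R i)" for i
    by (rule finite_subset[of _ "snd ` I"]) (force simp: R_def fin)+
  define f where "f n = card (R (int n + 1))" for n
  have R: "R i = {1..int (card (R i))}" if "1 \<le> i" for i
    using pos down[of i _ i] that by (intro down_closed_int finR) (auto simp: R_def)
  have anti: "f k \<le> f i" if "i \<le> k" for i k
  proof -
    have "R (int k + 1) \<subseteq> R (int i + 1)"
    proof
      fix j assume "j \<in> R (int k + 1)"
      then show "j \<in> R (int i + 1)"
        using down[of "int k + 1" j "int i + 1" j] pos[of "int k + 1" j] that by (simp add: R_def)
    qed
    then show ?thesis unfolding f_def by (intro card_mono finR)
  qed
  define n where "n = nat (Max (insert 0 (fst ` I)))"
  have "i \<le> int n" if "(i, j) \<in> I" for i j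
  proof -
    have "i \<le> Max (insert 0 (fst ` I))" using fin that by (intro Max_ge) force+
    then show ?thesis by (simp add: n_def)
  qed
  then have "R (int n + 1) = {}" by (force simp: R_def)
  then have "f n = 0" by (simp add: f_def)
  with partition_of_function[of f n] anti obtain \<alpha>
    where \<alpha>: "is_partition \<alpha>" "\<And>i. part \<alpha> (int i + 1) = int (f i)" by blast
  have "j \<le> part \<alpha> i \<longleftrightarrow> (i, j) \<in> I" if "1 \<le> i" "1 \<le> j" for i j
  proof -
    have "part \<alpha> i = int (card (R i))"
      using \<alpha>(2)[of "nat (i - 1)"] that by (simp add: f_def)
    then have "j \<le> part \<alpha> i \<longleftrightarrow> j \<in> R i" using R[OF that(1)] that by (metis atLeastAtMost_iff)
    then show ?thesis by (simp add: R_def)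
  qed
  with \<alpha>(1) show ?thesis by blast
qed

text \<open>The outer partition is the order ideal generated by the set, the inner one its complement in
  that ideal.\<close>

lemma order_convex_skew_diagram:
  assumes fin: "finite B" and pos: "\<And>i j. (i, j) \<in> B \<Longrightarrow> 1 \<le> i \<and> 1 \<le> j"
    and conv: "order_convex B"
  shows "is_skew_diagram B"
proof -
  define I where "I = {(i, j). 1 \<le> i \<and> 1 \<le> j \<and> (\<exists>(i', j')\<in>B. i \<le> i' \<and> j \<le> j')}"
  have "I \<subseteq> (\<Union>(i, j)\<in>B. {1..i} \<times> {1..j})" by (auto simp: I_def)
  then have finI: "finite I" by (rule finite_subset) (use fin in auto)
  have "\<exists>\<alpha>. is_partition \<alpha> \<and> (\<forall>i j. 1 \<le> i \<longrightarrow> 1 \<le> j \<longrightarrow> (j \<le> part \<alpha> i \<longleftrightarrow> (i, j) \<in> I))"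
  proof (rule order_ideal_partition[OF finI])
    show "1 \<le> i \<and> 1 \<le> j" if "(i, j) \<in> I" for i j using that by (auto simp: I_def)
    show "(i', j') \<in> I" if "(i, j) \<in> I" "1 \<le> i'" "i' \<le> i" "1 \<le> j'" "j' \<le> j" for i j i' j'
      using that by (auto simp: I_def intro: order_trans)
  qed
  then obtain \<alpha> where \<alpha>: "is_partition \<alpha>" "\<And>i j. 1 \<le> i \<Longrightarrow> 1 \<le> j \<Longrightarrow> j \<le> part \<alpha> i \<longleftrightarrow> (i, j) \<in> I"
    by blast
  have "\<exists>\<beta>. is_partition \<beta> \<and> (\<forall>i j. 1 \<le> i \<longrightarrow> 1 \<le> j \<longrightarrow> (j \<le> part \<beta> i \<longleftrightarrow> (i, j) \<in> I - B))"
  proof (rule order_ideal_partition)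
    show "finite (I - B)" using finI by simp
    show "1 \<le> i \<and> 1 \<le> j" if "(i, j) \<in> I - B" for i j using that by (auto simp: I_def)
    fix i j i' j'
    assume *: "(i, j) \<in> I - B" "1 \<le> i'" "i' \<le> i" "1 \<le> j'" "j' \<le> j"
    then obtain a b where ab: "(a, b) \<in> B" "i \<le> a" "j \<le> b" by (auto simp: I_def)
    have "(i', j') \<in> I" using * by (auto simp: I_def intro: order_trans)
    \<comment> \<open>Otherwise (i, j) would lie between (i', j') and (a, b), both in
      \<open>B\<close>.\<close>
    moreover have "(i', j') \<notin> B"
      using conv ab * unfolding order_convex_def by blast
    ultimately show "(i', j') \<in> I - B" by simp
  qed
  then obtain \<beta> where \<beta>: "is_partition \<beta>" "\<And>i j. 1 \<le> i \<Longrightarrow> 1 \<le> j \<Longrightarrow> j \<le> part \<beta> i \<longleftrightarrow> (i, j) \<in> I - B"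
    by blast
  have BI: "B \<subseteq> I" using pos by (force simp: I_def)
  have "part \<beta> i \<le> part \<alpha> i" for i
  proof (cases "1 \<le> i \<and> 1 \<le> part \<beta> i")
    case True
    then show ?thesis using \<alpha>(2)[of i "part \<beta> i"] \<beta>(2)[of i "part \<beta> i"] by simp
  next
    case False
    then have "part \<beta> i \<le> 0" by (auto simp: part_def)
    then show ?thesis using part_nonneg order_trans by blast
  qed
  moreover have "B = skew \<alpha> \<beta>"
  proof (rule set_eqI, clarify)
    fix i j
    show "(i, j) \<in> B \<longleftrightarrow> (i, j) \<in> skew \<alpha> \<beta>"
    proof (cases "1 \<le> i \<and> 1 \<le> j")
      case True
      then have "\<not> j \<le> part \<beta> i \<and> j \<le> part \<alpha> i \<longleftrightarrow> (i, j) \<in> B"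
        using \<alpha>(2)[of i j] \<beta>(2)[of i j] BI by auto
      then show ?thesis using True by (auto simp: skew_def)
    next
      case False
      then show ?thesis using pos[of i j] part_nonneg[of \<beta> i] by (auto simp: skew_def)
    qed
  qed
  ultimately show ?thesis
    using \<alpha>(1) \<beta>(1) by (auto simp: is_skew_diagram_def partition_contains_def)
qed

section \<open>Border strips and ribbons coincide\<close>

lemma share_edge_content:
  "share_edge x y \<Longrightarrow> content y = content x + 1 \<or> content y = content x - 1"
  unfolding share_edge_def content_def by arith

lemma share_edge_content_Suc:
  "share_edge x y \<and> content y = content x + 1 \<longleftrightarrow>
    y = (fst x, snd x + 1) \<or> y = (fst x - 1, snd x)"
  by (cases x; cases y) (auto simp: share_edge_def content_def)

lemma share_edge_sym: "share_edge x y \<longleftrightarrow> share_edge y x"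
  by (auto simp: share_edge_def)

text \<open>By convexity two squares of equal content would yield a 2x2 block, so contents are
  distinct. Edges change the content by one, so a walk from x to a larger content must somewhere
  step from \<open>content x\<close> to \<open>content x + 1\<close>, and distinctness makes that
  step start at x.\<close>

lemma border_strip_ribbon:
  assumes "border_strip B"
  shows "ribbon B"
proof -
  have conv: "order_convex B" and fin: "finite B" and ne: "B \<noteq> {}" and con: "edge_connected B"
    and no: "\<And>i j. \<not> {(i, j), (i, j + 1), (i + 1, j), (i + 1, j + 1)} \<subseteq> B"
    using assms skew_diagram_finite skew_diagram_order_convex by (auto simp: border_strip_def)
  have inj': "i = i'" if ij: "(i, j) \<in> B" "(i', j') \<in> B" "j - i = j' - i'" "i \<le> i'" for i j i' j'
  proof (rule ccontr)
    assume "i \<noteq> i'"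
    with that have "i + 1 \<le> i'" "j + 1 \<le> j'" by auto
    then have "(a, b) \<in> B" if "i \<le> a" "a \<le> i + 1" "j \<le> b" "b \<le> j + 1" for a b
      using conv ij that unfolding order_convex_def by (meson order_trans)
    then show False using no[of i j] by simp
  qed
  have inj: "inj_on content B"
  proof (rule inj_onI)
    fix x y assume "x \<in> B" "y \<in> B" "content x = content y"
    then show "x = y"
      using inj'[of "fst x" "snd x" "fst y" "snd y"] inj'[of "fst y" "snd y" "fst x" "snd x"]
      by (cases "fst x \<le> fst y") (auto simp: content_def prod_eq_iff)
  qed
  have "\<exists>z\<in>B. content z = content x + 1 \<and> share_edge x z"
    if xy: "x \<in> B" "y \<in> B" "content x < content y" for x y
  proof -
    have "(x, y) \<in> {(c, d). c \<in> B \<and> d \<in> B \<and> share_edge c d}\<^sup>*"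
      using con xy by (auto simp: edge_connected_def)
    then have "content x < content y \<longrightarrow>
        (\<exists>w\<in>B. \<exists>z\<in>B. content w = content x \<and> content z = content x + 1 \<and> share_edge w z)"
    proof (induction rule: rtrancl_induct)
      case (step y z)
      show ?case
      proof (cases "content x < content y")
        case True
        then show ?thesis using step by simp
      next
        case False
        show ?thesis
        proof
          assume "content x < content z"
          moreover have "content z = content y + 1 \<or> content z = content y - 1"
            using step(2) share_edge_content by auto
          ultimately have "content y = content x" "content z = content x + 1"
            using False by auto
          then show "\<exists>w\<in>B. \<exists>z\<in>B. content w = content x \<and> content z = content x + 1 \<and> share_edge w z"
            using step(2) by auto
        qed
      qed
    qed simp
    then show ?thesis using xy inj by (metis inj_onD)
  qed
  then show ?thesis using fin ne inj by (auto simp: ribbon_def)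
qed

text \<open>Each step of the walk goes right or up. The last two clauses record the squares passed
  on a straight run; together with the monotonicity they yield order-convexity.\<close>

lemma ribbon_steps:
  assumes "ribbon B" "x \<in> B" "y \<in> B" "content y = content x + int n"
  shows "(x, y) \<in> {(c, d). c \<in> B \<and> d \<in> B \<and> share_edge c d}\<^sup>* \<and> fst y \<le> fst x \<and> snd x \<le> snd y
    \<and> (fst x = fst y \<longrightarrow> (\<forall>b. snd x \<le> b \<longrightarrow> b \<le> snd y \<longrightarrow> (fst x, b) \<in> B))
    \<and> (snd x = snd y \<longrightarrow> (\<forall>a. fst y \<le> a \<longrightarrow> a \<le> fst x \<longrightarrow> (a, snd x) \<in> B))"
  using assms(2-)
proof (induction n arbitrary: x)
  case 0
  then have "x = y" using assms(1) by (auto simp: ribbon_def inj_on_def)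
  then show ?case using 0 by (cases x) auto
next
  case (Suc n)
  then obtain z where z: "z \<in> B" "content z = content x + 1" "share_edge x z"
    using assms(1) by (force simp: ribbon_def)
  have zy: "content y = content z + int n" using z Suc.prems by simp
  note IH = Suc.IH[OF z(1) Suc.prems(2) zy]
  have "(x, z) \<in> {(c, d). c \<in> B \<and> d \<in> B \<and> share_edge c d}" using z Suc.prems by simp
  with IH have 1: "(x, y) \<in> {(c, d). c \<in> B \<and> d \<in> B \<and> share_edge c d}\<^sup>*"
    by (meson converse_rtrancl_into_rtrancl)
  have "z = (fst x, snd x + 1) \<or> z = (fst x - 1, snd x)"
    using z share_edge_content_Suc by blast
  then show ?case
  proof
    assume zz: "z = (fst x, snd x + 1)"
    have "(fst x, b) \<in> B" if "fst x = fst y" "snd x \<le> b" "b \<le> snd y" for b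
    proof (cases "b = snd x")
      case True
      then show ?thesis using Suc.prems(1) by simp
    next
      case False
      then show ?thesis using IH that zz by simp
    qed
    then show ?thesis using 1 IH zz by auto
  next
    assume zz: "z = (fst x - 1, snd x)"
    have "(a, snd x) \<in> B" if "snd x = snd y" "fst y \<le> a" "a \<le> fst x" for a
    proof (cases "a = fst x")
      case True
      then show ?thesis using Suc.prems(1) by simp
    next
      case False
      then show ?thesis using IH that zz by simp
    qed
    then show ?thesis using 1 IH zz by auto
  qed
qed

lemma ribbon_border_strip:
  assumes rib: "ribbon B" and pos: "\<And>i j. (i, j) \<in> B \<Longrightarrow> 1 \<le> i \<and> 1 \<le> j"
  shows "border_strip B"
proof -
  let ?E = "{(c, d). c \<in> B \<and> d \<in> B \<and> share_edge c d}"
  have steps: "(x, y) \<in> ?E\<^sup>* \<and> fst y \<le> fst x \<and> snd x \<le> snd y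
    \<and> (fst x = fst y \<longrightarrow> (\<forall>b. snd x \<le> b \<longrightarrow> b \<le> snd y \<longrightarrow> (fst x, b) \<in> B))
    \<and> (snd x = snd y \<longrightarrow> (\<forall>a. fst y \<le> a \<longrightarrow> a \<le> fst x \<longrightarrow> (a, snd x) \<in> B))"
    if "x \<in> B" "y \<in> B" "content x \<le> content y" for x y
    using ribbon_steps[OF rib that(1,2), of "nat (content y - content x)"] that by simp
  have "sym ?E" by (auto simp: sym_def share_edge_sym)
  then have "sym (?E\<^sup>*)" by (rule sym_rtrancl)
  have "(x, y) \<in> ?E\<^sup>*" if "x \<in> B" "y \<in> B" for x y
  proof (cases "content x \<le> content y")
    case True
    then show ?thesis using steps that by blast
  next
    case False
    then have "(y, x) \<in> ?E\<^sup>*" using steps[OF that(2,1)] by simp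
    then show ?thesis using \<open>sym (?E\<^sup>*)\<close> by (rule symD[rotated])
  qed
  then have con: "edge_connected B" by (auto simp: edge_connected_def)
  have "order_convex B"
    unfolding order_convex_def
  proof (intro allI impI)
    fix i j i' j' a b
    assume *: "(i, j) \<in> B" "(i', j') \<in> B" "i \<le> a" "a \<le> i'" "j \<le> b" "b \<le> j'"
    show "(a, b) \<in> B"
    proof (cases "content (i, j) \<le> content (i', j')")
      case True
      \<comment> \<open>The walk from (i, j) to (i', j') never goes down, so both squares lie in one
        row.\<close>
      have "i = i'" "a = i" using steps[OF *(1,2) True] * by auto
      then show ?thesis using steps[OF *(1,2) True] * by auto
    next
      case False
      then have le: "content (i', j') \<le> content (i, j)" by simp
      have "j = j'" "b = j" using steps[OF *(2,1) le] * by auto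
      then show ?thesis using steps[OF *(2,1) le] * by auto
    qed
  qed
  then have "is_skew_diagram B"
    using rib pos by (intro order_convex_skew_diagram) (auto simp: ribbon_def)
  moreover have "\<not> {(i, j), (i, j + 1), (i + 1, j), (i + 1, j + 1)} \<subseteq> B" for i j
  proof
    assume "{(i, j), (i, j + 1), (i + 1, j), (i + 1, j + 1)} \<subseteq> B"
    then have "(i, j) = (i + 1, j + 1)"
      using rib by (intro inj_onD[of content B]) (auto simp: ribbon_def content_def)
    then show False by simp
  qed
  ultimately show ?thesis using con rib by (auto simp: border_strip_def ribbon_def)
qed

lemma ribbon_content_image:
  assumes "ribbon B"
  shows "content ` B = {Min (content ` B)..Max (content ` B)}"
proof
  have fin: "finite (content ` B)" "content ` B \<noteq> {}" using assms by (auto simp: ribbon_def)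
  then show "content ` B \<subseteq> {Min (content ` B)..Max (content ` B)}" by auto
  show "{Min (content ` B)..Max (content ` B)} \<subseteq> content ` B"
  proof
    fix c assume "c \<in> {Min (content ` B)..Max (content ` B)}"
    then have "Min (content ` B) \<le> c" "c \<le> Max (content ` B)" by auto
    then show "c \<in> content ` B"
    proof (induction c rule: int_ge_induct)
      case base
      then show ?case using fin by simp
    next
      case (step c)
      then obtain x where x: "x \<in> B" "content x = c" by auto
      obtain y where "y \<in> B" "content y = Max (content ` B)" using Max_in[OF fin] by auto
      then obtain z where "z \<in> B" "content z = content x + 1"
        using assms x step by (force simp: ribbon_def)
      then show ?case using x by (metis image_eqI)
    qed
  qed
qed

lemma ribbon_card:
  assumes "ribbon B"
  shows "int (card B) = Max (content ` B) - (Min (content ` B) - 1)"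
proof -
  have "card B = card (content ` B)" using assms by (simp add: ribbon_def card_image)
  also have "\<dots> = nat (Max (content ` B) - Min (content ` B) + 1)"
    by (subst ribbon_content_image[OF assms]) simp
  finally show ?thesis
    using assms Min_le_iff[of "content ` B"] Max_in[of "content ` B"] by (force simp: ribbon_def)
qed

section \<open>Skew shapes by diagonals\<close>

lemma sum_int_shift: "(\<Sum>c\<in>{a..b::int}. f (c + 1)) = (\<Sum>c\<in>{a + 1..b + 1}. f c)"
  by (rule sum.reindex_bij_witness[of _ "\<lambda>c. c - 1" "\<lambda>c. c + 1"]) auto

text \<open>\<open>m c\<close> is the row just before the first square of content c, and
  \<open>l c\<close> the row of the last one. The final two assumptions keep rows and columns
  positive.\<close>

locale content_profile =
  fixes l m :: "int \<Rightarrow> int" and K :: int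
  assumes le: "m c \<le> l c"
    and l_step: "l (c + 1) = l c \<or> l (c + 1) = l c - 1"
    and m_step: "m (c + 1) = m c \<or> m (c + 1) = m c - 1"
    and outside: "K \<le> \<bar>c\<bar> \<Longrightarrow> l c = m c"
    and m_nonneg: "0 \<le> m c" and m_nonneg': "0 \<le> m c + c"
begin

definition squares :: "square set" where
  "squares = {(i, j). m (j - i) < i \<and> i \<le> l (j - i)}"

definition rows :: "int \<Rightarrow> int set" where
  "rows c = {m c<..l c}"

definition sq :: "int \<Rightarrow> int \<Rightarrow> square" where
  "sq c i = (i, i + c)"

text \<open>Equivalently, the diagonal k + 1 has one square more than the diagonal k. This replaces
  the parity of the snake length, see \<open>left_snake_iff\<close>.\<close>

definition left :: "int \<Rightarrow> bool" where
  "left k \<longleftrightarrow> l (k + 1) = l k \<and> m (k + 1) = m k - 1"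

definition right :: "int \<Rightarrow> bool" where
  "right k \<longleftrightarrow> l (k + 1) = l k - 1 \<and> m (k + 1) = m k"

lemma sq_squares [simp]: "sq c i \<in> squares \<longleftrightarrow> i \<in> rows c"
  by (auto simp: sq_def squares_def rows_def)

lemma content_sq [simp]: "content (sq c i) = c"
  by (simp add: sq_def content_def)

lemma fst_sq [simp]: "fst (sq c i) = i"
  by (simp add: sq_def)

lemma sq_collapse [simp]: "sq (content x) (fst x) = x"
  by (simp add: sq_def content_def)

lemma fst_rows: "x \<in> squares \<Longrightarrow> fst x \<in> rows (content x)"
  by (metis sq_collapse sq_squares)

lemma share_edge_sq: "share_edge (sq c i) (sq (c + 1) i') \<longleftrightarrow> i' = i \<or> i' = i - 1"
  using share_edge_content_Suc[of "sq c i" "sq (c + 1) i'"] by (auto simp: sq_def content_def)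

lemma finite_rows [simp]: "finite (rows c)"
  by (simp add: rows_def)

lemma card_rows: "int (card (rows c)) = l c - m c"
  using le[of c] by (simp add: rows_def)

lemma rows_outside: "K \<le> \<bar>c\<bar> \<Longrightarrow> rows c = {}"
  using outside by (simp add: rows_def)

lemma diagonal_eq: "{x \<in> squares. content x = c} = sq c ` rows c"
proof
  show "{x \<in> squares. content x = c} \<subseteq> sq c ` rows c"
  proof
    fix x assume "x \<in> {x \<in> squares. content x = c}"
    then have "x = sq c (fst x)" "fst x \<in> rows c" using sq_collapse[of x] fst_rows[of x] by auto
    then show "x \<in> sq c ` rows c" by (rule image_eqI)
  qed
qed auto

lemma inj_sq: "inj_on (sq c) A"
  by (auto simp: inj_on_def sq_def)

lemma finite_diagonal: "finite {x \<in> squares. content x = c}"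
  by (simp add: diagonal_eq)

lemma card_diagonal: "int (card {x \<in> squares. content x = c}) = l c - m c"
  by (simp add: diagonal_eq card_image inj_sq card_rows)

lemma content_bound: "x \<in> squares \<Longrightarrow> content x \<in> {-K..K}"
  using rows_outside[of "content x"] fst_rows[of x] by (cases "K \<le> \<bar>content x\<bar>") auto

lemma finite_squares: "finite squares"
proof -
  have "squares \<subseteq> (\<Union>c\<in>{-K..K}. {x \<in> squares. content x = c})"
    using content_bound by auto
  then show ?thesis by (rule finite_subset) (auto simp: finite_diagonal)
qed

lemma squares_pos: "(i, j) \<in> squares \<Longrightarrow> 1 \<le> i \<and> 1 \<le> j"
  using m_nonneg[of "j - i"] m_nonneg'[of "j - i"] by (simp add: squares_def)

section \<open>Counting left and right snakes\<close>

lemma left_bound: "left k \<Longrightarrow> \<bar>k + 1\<bar> < K"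
  using outside[of "k + 1"] le[of k] by (auto simp: left_def intro: ccontr)

lemma right_bound: "right k \<Longrightarrow> \<bar>k\<bar> < K"
  using outside[of k] le[of "k + 1"] by (auto simp: right_def intro: ccontr)

lemma not_left_right: "left k \<Longrightarrow> \<not> right k"
  by (simp add: left_def right_def)

lemma finite_left: "finite {k. left k}"
  by (rule finite_subset[of _ "{-K-1..K}"]) (auto dest!: left_bound)

lemma finite_right: "finite {k. right k}"
  by (rule finite_subset[of _ "{-K..K}"]) (auto dest!: right_bound)

lemma sum_of_bool_left: "(\<Sum>k\<in>{-K-1..K}. of_bool (left k)) = int (card {k. left k})"
proof -
  have "{-K-1..K} \<inter> Collect left = Collect left" using left_bound by force
  then show ?thesis by simp
qed

lemma sum_of_bool_right: "(\<Sum>k\<in>{-K-1..K}. of_bool (right k)) = int (card {k. right k})"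
proof -
  have "{-K-1..K} \<inter> Collect right = Collect right" using right_bound by force
  then show ?thesis by simp
qed

text \<open>Starting at -K - 1 lets both k and k + 1 run over all contents with a non-empty
  diagonal; the extra border terms vanish.\<close>

lemma sum_shift_outside:
  assumes "\<And>c. K \<le> \<bar>c\<bar> \<Longrightarrow> f c = (0::int)"
  shows "(\<Sum>c\<in>{-K-1..K}. f (c + 1)) = (\<Sum>c\<in>{-K..K}. f c)"
    and "(\<Sum>c\<in>{-K-1..K}. f c) = (\<Sum>c\<in>{-K..K}. f c)"
proof -
  show "(\<Sum>c\<in>{-K-1..K}. f (c + 1)) = (\<Sum>c\<in>{-K..K}. f c)"
    unfolding sum_int_shift by (rule sum.mono_neutral_right) (auto intro!: assms)
  show "(\<Sum>c\<in>{-K-1..K}. f c) = (\<Sum>c\<in>{-K..K}. f c)"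
    by (rule sum.mono_neutral_right) (auto intro!: assms)
qed

text \<open>The length of the diagonals rises by one at a left snake, falls by one at a right snake
  and is 0 far out on both sides, so its differences telescope to 0.\<close>

lemma card_left_eq_card_right: "card {k. left k} = card {k. right k}"
proof -
  let ?d = "\<lambda>c. l c - m c"
  have "of_bool (left k) - of_bool (right k) = ?d (k + 1) - ?d k" for k
    using l_step[of k] m_step[of k] by (auto simp: left_def right_def)
  then have "(\<Sum>k\<in>{-K-1..K}. of_bool (left k) - of_bool (right k))
      = (\<Sum>k\<in>{-K-1..K}. ?d (k + 1) - ?d k)"
    by simp
  also have "\<dots> = (\<Sum>k\<in>{-K-1..K}. ?d (k + 1)) - (\<Sum>k\<in>{-K-1..K}. ?d k)"
    by (rule sum_subtractf)
  also have "\<dots> = 0"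
    using sum_shift_outside[of ?d] outside by simp
  finally show ?thesis
    by (simp add: sum_subtractf sum_of_bool_left sum_of_bool_right)
qed

text \<open>\<open>diagonal\<close> runs only downwards from its corner, so it is the full diagonal
  once the corner is the first square there. Both kinds of corners are.\<close>

lemma diagonal_first:
  assumes "(i, j) \<in> squares" "(i - 1, j - 1) \<notin> squares"
  shows "diagonal squares (i, j) = {x \<in> squares. content x = j - i}"
proof -
  have i: "i = m (j - i) + 1" using assms by (auto simp: squares_def)
  show ?thesis
  proof
    show "diagonal squares (i, j) \<subseteq> {x \<in> squares. content x = j - i}"
      by (auto simp: diagonal_def content_def)
    show "{x \<in> squares. content x = j - i} \<subseteq> diagonal squares (i, j)"
    proof
      fix x assume x: "x \<in> {x \<in> squares. content x = j - i}"
      then have "i \<le> fst x" using fst_rows[of x] i by (auto simp: rows_def)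
      then have "x = (i + int (nat (fst x - i)), j + int (nat (fst x - i)))"
        using x by (auto simp: content_def prod_eq_iff)
      then show "x \<in> diagonal squares (i, j)"
        using x unfolding diagonal_def fst_conv snd_conv by blast
    qed
  qed
qed

lemma card_diagonals: "int (card {x \<in> squares. content x \<in> X}) = (\<Sum>c\<in>{-K..K}. (l c - m c) * of_bool (c \<in> X))"
proof -
  have "{x \<in> squares. content x \<in> X} = (\<Union>c\<in>X \<inter> {-K..K}. {x \<in> squares. content x = c})"
    using content_bound by blast
  then have "int (card {x \<in> squares. content x \<in> X})
      = int (\<Sum>c\<in>X \<inter> {-K..K}. card {x \<in> squares. content x = c})"
    by (simp add: finite_diagonal disjoint_iff card_UN_disjoint)
  also have "\<dots> = (\<Sum>c\<in>X \<inter> {-K..K}. l c - m c)"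
    by (simp add: card_diagonal)
  also have "\<dots> = (\<Sum>c\<in>{-K..K}. (l c - m c) * of_bool (c \<in> X))"
    by (rule sum.mono_neutral_cong_left) auto
  finally show ?thesis .
qed

lemma first_square_neighbours:
  assumes "m c < l c"
  shows "(m c + 1, m c + 1 + c) \<in> squares" "(m c, m c + c) \<notin> squares"
    and "(m c, m c + 1 + c) \<in> squares \<longleftrightarrow> m (c + 1) = m c - 1"
    and "(m c + 1, m c + c) \<in> squares \<longleftrightarrow> m c = m (c - 1)"
  using assms l_step[of c] l_step[of "c - 1"] m_step[of c] m_step[of "c - 1"]
  by (auto simp: squares_def algebra_simps)

text \<open>The path formed by two adjacent diagonals of contents \<open>k\<close> and \<open>k + 1\<close> starts, from the top,
  with content \<open>k + 1\<close> iff \<open>m k - m (k + 1) = 1\<close>. Hence the contribution of a diagonal to the rank is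
  its length times a difference of consecutive values of \<open>m k - m (k + 1)\<close>, and summation by parts
  gives the number of left snakes.\<close>

lemma rank_squares: "rank squares = int (card {k. left k})"
proof -
  define a where "a k = m k - m (k + 1)" for k
  define d where "d c = l c - m c" for c
  define Out where "Out = {c. m c < l c \<and> m c \<noteq> m (c - 1) \<and> m (c + 1) = m c}"
  define In where "In = {c. m c < l c \<and> m c = m (c - 1) \<and> m (c + 1) = m c - 1}"
  have first: "i = m (j - i) + 1 \<and> m (j - i) < l (j - i)"
    if "(i, j) \<in> squares" "(i - 1, j - 1) \<notin> squares" for i j
    using that by (auto simp: squares_def)
  \<comment> \<open>The definition of an outside corner is silent on (i - 1, j - 1); that square is
    missing too, because the boundaries move by at most one.\<close>
  have corner: "(i - 1, j - 1) \<notin> squares"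
    if "(i - 1, j) \<notin> squares" "(i, j) \<in> squares" for i j
    using that l_step[of "j - i"] m_step[of "j - i"] by (auto simp: squares_def algebra_simps)
  have out: "(\<Union>c\<in>outside_top_corners squares. diagonal squares c) = {x \<in> squares. content x \<in> Out}"
  proof
    show "(\<Union>c\<in>outside_top_corners squares. diagonal squares c) \<subseteq> {x \<in> squares. content x \<in> Out}"
    proof
      fix x assume "x \<in> (\<Union>c\<in>outside_top_corners squares. diagonal squares c)"
      then obtain i j where ij: "(i, j) \<in> squares" "(i - 1, j) \<notin> squares" "(i, j - 1) \<notin> squares"
        and x: "x \<in> diagonal squares (i, j)" by (auto simp: outside_top_corners_def)
      have nd: "(i - 1, j - 1) \<notin> squares" using corner ij by blast
      define c where "c = j - i"
      have c: "i = m c + 1" "j = m c + 1 + c" "m c < l c" using first[OF ij(1) nd] by (auto simp: c_def)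
      then have "c \<in> Out"
        using ij first_square_neighbours[OF c(3)] m_step[of c] by (auto simp: Out_def algebra_simps)
      then show "x \<in> {x \<in> squares. content x \<in> Out}"
        using x diagonal_first[OF ij(1) nd] by (auto simp: c_def)
    qed
    show "{x \<in> squares. content x \<in> Out} \<subseteq> (\<Union>c\<in>outside_top_corners squares. diagonal squares c)"
    proof
      fix x assume x: "x \<in> {x \<in> squares. content x \<in> Out}"
      define c where "c = content x"
      have c: "m c < l c" "c \<in> Out" using x by (auto simp: Out_def c_def)
      note n = first_square_neighbours[OF c(1)]
      have "(m c + 1, m c + 1 + c) \<in> outside_top_corners squares"
        using n c(2) by (auto simp: outside_top_corners_def Out_def algebra_simps)
      moreover have "x \<in> diagonal squares (m c + 1, m c + 1 + c)"
        using diagonal_first[OF n(1)] n(2) x by (simp add: c_def algebra_simps)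
      ultimately show "x \<in> (\<Union>c\<in>outside_top_corners squares. diagonal squares c)" by blast
    qed
  qed
  have "in": "(\<Union>c\<in>inside_top_corners squares. diagonal squares c) = {x \<in> squares. content x \<in> In}"
  proof
    show "(\<Union>c\<in>inside_top_corners squares. diagonal squares c) \<subseteq> {x \<in> squares. content x \<in> In}"
    proof
      fix x assume "x \<in> (\<Union>c\<in>inside_top_corners squares. diagonal squares c)"
      then obtain i j where ij: "(i, j) \<in> squares" "(i - 1, j) \<in> squares" "(i, j - 1) \<in> squares"
        and nd: "(i - 1, j - 1) \<notin> squares"
        and x: "x \<in> diagonal squares (i, j)" by (auto simp: inside_top_corners_def)
      define c where "c = j - i"
      have c: "i = m c + 1" "j = m c + 1 + c" "m c < l c" using first[OF ij(1) nd] by (auto simp: c_def)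
      then have "c \<in> In"
        using ij first_square_neighbours[OF c(3)] by (auto simp: In_def algebra_simps)
      then show "x \<in> {x \<in> squares. content x \<in> In}"
        using x diagonal_first[OF ij(1) nd] by (auto simp: c_def)
    qed
    show "{x \<in> squares. content x \<in> In} \<subseteq> (\<Union>c\<in>inside_top_corners squares. diagonal squares c)"
    proof
      fix x assume x: "x \<in> {x \<in> squares. content x \<in> In}"
      define c where "c = content x"
      have c: "m c < l c" "c \<in> In" using x by (auto simp: In_def c_def)
      note n = first_square_neighbours[OF c(1)]
      have "(m c + 1, m c + 1 + c) \<in> inside_top_corners squares"
        using n c(2) by (auto simp: inside_top_corners_def In_def algebra_simps)
      moreover have "x \<in> diagonal squares (m c + 1, m c + 1 + c)"
        using diagonal_first[OF n(1)] n(2) x by (simp add: c_def algebra_simps)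
      ultimately show "x \<in> (\<Union>c\<in>inside_top_corners squares. diagonal squares c)" by blast
    qed
  qed
  \<comment> \<open>Outside corners sit where \<open>a\<close> falls from 1 to 0, inside corners
    where it rises from 0 to 1.\<close>
  have pt: "d c * of_bool (c \<in> Out) - d c * of_bool (c \<in> In) = d c * a (c - 1) - d c * a c" for c
  proof (cases "m c < l c")
    case True
    then have "of_bool (c \<in> Out) - of_bool (c \<in> In) = a (c - 1) - a c"
      using m_step[of c] m_step[of "c - 1"] by (auto simp: Out_def In_def a_def)
    then show ?thesis by (metis right_diff_distrib)
  next
    case False
    then have "d c = 0" using le[of c] by (simp add: d_def)
    then show ?thesis by simp
  qed
  have d0: "d c = 0" if "K \<le> \<bar>c\<bar>" for c using outside[OF that] by (simp add: d_def)
  have "rank squares = (\<Sum>c\<in>{-K..K}. d c * a (c - 1) - d c * a c)"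
    unfolding rank_def out "in" card_diagonals
    by (simp only: sum_subtractf[symmetric] pt[symmetric]) (simp only: d_def)
  also have "\<dots> = (\<Sum>c\<in>{-K..K}. d c * a (c - 1)) - (\<Sum>c\<in>{-K..K}. d c * a c)"
    by (rule sum_subtractf)
  also have "\<dots> = (\<Sum>k\<in>{-K-1..K}. d (k + 1) * a k) - (\<Sum>k\<in>{-K-1..K}. d k * a k)"
    using sum_shift_outside(1)[of "\<lambda>c. d c * a (c - 1)"] sum_shift_outside(2)[of "\<lambda>c. d c * a c"] d0
    by simp
  also have "\<dots> = (\<Sum>k\<in>{-K-1..K}. d (k + 1) * a k - d k * a k)"
    by (rule sum_subtractf[symmetric])
  \<comment> \<open>\<open>a k\<close> is 1 only if \<open>m\<close> drops, and then the diagonal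
    grows exactly if \<open>l\<close> stays.\<close>
  also have "\<dots> = (\<Sum>k\<in>{-K-1..K}. of_bool (left k))"
  proof (rule sum.cong[OF refl])
    fix k
    show "d (k + 1) * a k - d k * a k = of_bool (left k)"
      using m_step[of k] l_step[of k] by (auto simp: d_def a_def left_def)
  qed
  finally show ?thesis by (simp only: sum_of_bool_left)
qed

end

section \<open>Sweeping the diagonals\<close>

text \<open>Uniqueness of a perfect matching on a path, by a chain of forced moves: p must go to p -
  1, so p - 1 must go to p - 2, and so on; likewise upwards, starting from p + 1, which must
  stay.\<close>

lemma inj_shift_below:
  fixes h :: "int \<Rightarrow> int"
  assumes inj: "inj_on h {a<..b}" and adj: "\<And>i. i \<in> {a<..b} \<Longrightarrow> h i = i \<or> h i = i - 1"
    and avoid: "\<And>i. i \<in> {a<..b} \<Longrightarrow> h i \<noteq> p" and p: "a \<le> p" "p \<le> b" and i: "i \<in> {a<..b}"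
  shows "h i = (if i \<le> p then i - 1 else i)"
proof -
  have low: "h i = i - 1" if "i \<le> p" "a < i" for i
    using that
  proof (induction i rule: int_le_induct)
    case base
    then show ?case using adj[of p] avoid[of p] p by auto
  next
    case (step i)
    then have "h i = i - 1" by simp
    then show ?case
      using adj[of "i - 1"] inj_onD[OF inj, of "i - 1" i] step p by auto
  qed
  have high: "h i = i" if "p + 1 \<le> i" "i \<le> b" for i
    using that
  proof (induction i rule: int_ge_induct)
    case base
    then show ?case using adj[of "p + 1"] avoid[of "p + 1"] p by auto
  next
    case (step i)
    then have "h i = i" by simp
    then show ?case
      using adj[of "i + 1"] inj_onD[OF inj, of i "i + 1"] step p by auto
  qed
  show ?thesis using low[of i] high[of i] i by auto
qed

context content_profile
begin

text \<open>The exhaustive form of an interval set: every left and every right snake is used exactly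
  once. \<open>pairing_iff\<close> derives this from the number of intervals.\<close>

definition pairing :: "(int \<times> int) set \<Rightarrow> bool" where
  "pairing I \<longleftrightarrow> fst ` I = {k. left k} \<and> snd ` I = {k. right k} \<and>
     inj_on fst I \<and> inj_on snd I \<and> (\<forall>(u, v)\<in>I. u < v)"

text \<open>The labels to be seen on diagonal c. The strip of (u, v) has the contents u + 1, ..., v,
  whence one strict and one weak inequality.\<close>

definition alive :: "(int \<times> int) set \<Rightarrow> int \<Rightarrow> int set" where
  "alive I c = {v. \<exists>u. (u, v) \<in> I \<and> u < c \<and> c \<le> v}"

text \<open>A label map \<open>t\<close> sends the content \<open>c\<close> and row \<open>i\<close> of a square to the largest content
  occurring in the strip that contains this square. The parameter \<open>q k\<close> is the row of the square
  of the right snake \<open>k\<close> that lies on none of the prescribed links.\<close>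

definition label_step :: "(int \<Rightarrow> int) \<Rightarrow> (int \<times> int) set \<Rightarrow> int \<Rightarrow> (int \<Rightarrow> int) \<Rightarrow> (int \<Rightarrow> int) \<Rightarrow> bool" where
  "label_step q I c f g \<longleftrightarrow> bij_betw g (rows c) (alive I c) \<and>
     (\<forall>i\<in>rows c. \<forall>i'\<in>rows (c + 1). g i = f i' \<longrightarrow> i' = i \<or> i' = i - 1) \<and>
     (right c \<longrightarrow> (\<forall>i\<in>rows c. (i < q c \<longrightarrow> g i = f i) \<and> (q c < i \<longrightarrow> g i = f (i - 1))))"

definition labelling :: "(int \<Rightarrow> int) \<Rightarrow> (int \<times> int) set \<Rightarrow> (int \<Rightarrow> int \<Rightarrow> int) \<Rightarrow> bool" where
  "labelling q I t \<longleftrightarrow> (\<forall>c. label_step q I c (t (c + 1)) (t c))"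

section \<open>Labels entering and leaving\<close>

lemma pairing_left: "pairing I \<Longrightarrow> (u, v) \<in> I \<Longrightarrow> left u"
  by (force simp: pairing_def)

lemma pairing_right: "pairing I \<Longrightarrow> (u, v) \<in> I \<Longrightarrow> right v"
  by (force simp: pairing_def)

lemma pairing_less: "pairing I \<Longrightarrow> (u, v) \<in> I \<Longrightarrow> u < v"
  by (auto simp: pairing_def)

lemma pairing_unique_left: "pairing I \<Longrightarrow> (u, v) \<in> I \<Longrightarrow> (u', v) \<in> I \<Longrightarrow> u = u'"
  by (force simp: pairing_def inj_on_def)

lemma pairing_unique_right: "pairing I \<Longrightarrow> (u, v) \<in> I \<Longrightarrow> (u, v') \<in> I \<Longrightarrow> v = v'"
  by (force simp: pairing_def inj_on_def)

lemma pairing_ex_right: "pairing I \<Longrightarrow> left u \<Longrightarrow> \<exists>v. (u, v) \<in> I"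
  by (force simp: pairing_def set_eq_iff image_iff)

lemma pairing_ex_left: "pairing I \<Longrightarrow> right v \<Longrightarrow> \<exists>u. (u, v) \<in> I"
  by (force simp: pairing_def set_eq_iff image_iff)

lemma alive_outside:
  assumes "pairing I" "K \<le> \<bar>c\<bar>"
  shows "alive I c = {}"
proof -
  have False if "(u, v) \<in> I" "u < c" "c \<le> v" for u v
    using left_bound[OF pairing_left[OF assms(1) that(1)]]
      right_bound[OF pairing_right[OF assms(1) that(1)]] that assms(2) by linarith
  then show ?thesis by (auto simp: alive_def)
qed

text \<open>No strip starts at c, since a right index is never a left one; so on the way down from c
  + 1 the label c enters and none leaves.\<close>

lemma alive_right:
  assumes "pairing I" "right c"
  shows "alive I c = insert c (alive I (c + 1))" and "c \<notin> alive I (c + 1)"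
proof -
  obtain u where u: "(u, c) \<in> I" "u < c" using pairing_ex_left pairing_less assms by blast
  have "u' \<noteq> c" if "(u', v) \<in> I" for u' v
    using pairing_left[OF assms(1) that] not_left_right assms(2) by blast
  then have "u' < c + 1 \<longleftrightarrow> u' < c" if "(u', v) \<in> I" for u' v using that by force
  then show "alive I c = insert c (alive I (c + 1))"
    using u by (auto simp: alive_def)
  show "c \<notin> alive I (c + 1)" by (auto simp: alive_def)
qed

lemma alive_left:
  assumes "pairing I" "(c, v) \<in> I"
  shows "alive I c = alive I (c + 1) - {v}" and "v \<in> alive I (c + 1)"
proof -
  have "v' \<noteq> c" if "(u', v') \<in> I" for u' v'
    using pairing_right[OF assms(1) that] pairing_left[OF assms] not_left_right by blast
  then have *: "c + 1 \<le> v' \<longleftrightarrow> c \<le> v'" if "(u', v') \<in> I" for u' v' using that by force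
  show "alive I c = alive I (c + 1) - {v}"
  proof (rule set_eqI)
    fix w
    show "w \<in> alive I c \<longleftrightarrow> w \<in> alive I (c + 1) - {v}"
      using * pairing_unique_left[OF assms(1)] pairing_unique_right[OF assms(1)] assms(2)
      by (auto simp: alive_def) (metis order_less_le zless_add1_eq)+
  qed
  show "v \<in> alive I (c + 1)" using assms pairing_less[OF assms] by (auto simp: alive_def intro!: exI[of _ c])
qed

lemma alive_same:
  assumes "pairing I" "\<not> left c" "\<not> right c"
  shows "alive I c = alive I (c + 1)"
proof -
  have "u \<noteq> c \<and> v \<noteq> c" if "(u, v) \<in> I" for u v
    using pairing_left pairing_right assms that by blast
  then have "u < c \<and> c \<le> v \<longleftrightarrow> u < c + 1 \<and> c + 1 \<le> v" if "(u, v) \<in> I" for u v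
    using that by force
  then show ?thesis by (auto simp: alive_def)
qed

lemma label_step_outside: "pairing I \<Longrightarrow> K \<le> \<bar>c\<bar> \<Longrightarrow> label_step q I c f g"
  by (simp add: label_step_def rows_outside alive_outside bij_betw_def)

text \<open>The neighbours of the rows of content c range over \<open>{m c..l c}\<close>, one
  position more than there are rows. One position p carries no surviving label: at a left snake the
  row of the label that leaves, otherwise the end of the range lying outside the shape. This treats
  three of the four kinds of snakes uniformly.\<close>

lemma label_step_missing:
  assumes "pairing I" "\<not> right c" "bij_betw f (rows (c + 1)) (alive I (c + 1))"
  shows "\<exists>p. m c \<le> p \<and> p \<le> l c \<and> rows (c + 1) - {p} = {m c..l c} - {p} \<and>
    bij_betw f ({m c..l c} - {p}) (alive I c)"
proof (cases "left c")
  case True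
  then obtain v where v: "(c, v) \<in> I" using pairing_ex_right assms by blast
  obtain p where p: "p \<in> rows (c + 1)" "f p = v"
    using alive_left(2)[OF assms(1) v] assms(3) by (metis bij_betw_imp_surj_on imageE)
  have rows: "rows (c + 1) = {m c..l c}" using True by (auto simp: rows_def left_def)
  have "bij_betw f (rows (c + 1) - {p}) (alive I (c + 1) - {v})"
    using bij_betw_DiffI[OF assms(3), of "{p}" "{v}"] p alive_left(2)[OF assms(1) v] by simp
  then show ?thesis using p(1) rows alive_left(1)[OF assms(1) v] by (auto intro!: exI[of _ p])
next
  case False
  then have same: "alive I c = alive I (c + 1)" using alive_same assms by blast
  consider "l (c + 1) = l c" "m (c + 1) = m c" | "l (c + 1) = l c - 1" "m (c + 1) = m c - 1"
    using False assms(2) l_step[of c] m_step[of c] by (auto simp: left_def right_def)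
  then show ?thesis
  proof cases
    case 1
    then have "rows (c + 1) = {m c..l c} - {m c}" by (auto simp: rows_def)
    then show ?thesis using assms(3) same le by (auto intro!: exI[of _ "m c"])
  next
    case 2
    then have "rows (c + 1) = {m c..l c} - {l c}" by (auto simp: rows_def)
    then show ?thesis using assms(3) same le by (auto intro!: exI[of _ "l c"])
  qed
qed

text \<open>One step of the sweep. At a right snake \<open>q c\<close> gets the new label and the
  other rows copy their prescribed partners; elsewhere the surviving labels sit on an interval with
  one gap and \<open>inj_shift_below\<close> forces them into place.\<close>

lemma label_step_unique_existence:
  assumes I: "pairing I" and f: "bij_betw f (rows (c + 1)) (alive I (c + 1))"
    and q: "right c \<Longrightarrow> q c \<in> rows c"
  shows "\<exists>G. label_step q I c f G \<and> (\<forall>g. label_step q I c f g \<longrightarrow> (\<forall>i\<in>rows c. g i = G i))"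
proof (cases "right c")
  case True
  have lm: "l (c + 1) = l c - 1" "m (c + 1) = m c" using True by (auto simp: right_def)
  have qc: "m c < q c" "q c \<le> l c" using q[OF True] by (auto simp: rows_def)
  define h where "h i = (if i < q c then i else i - 1)" for i
  define G where "G i = (if i = q c then c else f (h i))" for i
  have h: "bij_betw h (rows c - {q c}) (rows (c + 1))"
    by (rule bij_betwI[where g = "\<lambda>i. if i < q c then i else i + 1"])
      (use lm qc in \<open>auto simp: h_def rows_def\<close>)
  note al = alive_right[OF I True]
  have "bij_betw (f \<circ> h) (rows c - {q c}) (alive I (c + 1))"
    using h f by (rule bij_betw_trans)
  then have "bij_betw G (rows c - {q c}) (alive I (c + 1))"
    by (rule bij_betw_cong[THEN iffD1, rotated]) (auto simp: G_def)
  moreover have "G (q c) = c" by (simp add: G_def)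
  ultimately have "bij_betw G (insert (q c) (rows c - {q c})) (insert c (alive I (c + 1)))"
    using al(2) by (metis notIn_Un_bij_betw3 Diff_iff singletonI Un_insert_right Un_empty_right)
  then have bij: "bij_betw G (rows c) (alive I c)"
    using q[OF True] by (simp add: al insert_absorb)
  have "i' = i \<or> i' = i - 1" if "i \<in> rows c" "i' \<in> rows (c + 1)" "G i = f i'" for i i'
  proof (cases "i = q c")
    case True
    then have "f i' = c" using that by (simp add: G_def)
    then show ?thesis using f that al by (metis bij_betwE)
  next
    case False
    then have "h i \<in> rows (c + 1)" using h that by (metis Diff_iff bij_betwE singletonD)
    moreover have "f (h i) = f i'" using that False by (simp add: G_def)
    ultimately have "i' = h i" using f that by (metis bij_betw_imp_inj_on inj_onD)
    then show ?thesis by (simp add: h_def)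
  qed
  with bij have G: "label_step q I c f G" by (auto simp: label_step_def G_def h_def)
  have "g i = G i" if g: "label_step q I c f g" and i: "i \<in> rows c" for g i
  proof -
    have eq: "g i = f (h i)" if "i \<in> rows c" "i \<noteq> q c" for i
      using g True that by (auto simp: label_step_def h_def)
    have bij: "bij_betw g (rows c) (alive I c)" using g by (simp add: label_step_def)
    then obtain j where j: "j \<in> rows c" "g j = c" using al(1) by (metis bij_betw_imp_surj_on imageE insertI1)
    \<comment> \<open>All other rows repeat labels of the diagonal c + 1, and c is not among
      those.\<close>
    have "j = q c"
    proof (rule ccontr)
      assume "j \<noteq> q c"
      then have "c = f (h j)" "h j \<in> rows (c + 1)" using eq j h by (auto dest: bij_betwE)
      then show False using f al(2) by (metis bij_betwE)
    qed
    then show ?thesis using j eq i by (auto simp: G_def)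
  qed
  with G show ?thesis by blast
next
  case False
  obtain p where p: "m c \<le> p" "p \<le> l c" and rows: "rows (c + 1) - {p} = {m c..l c} - {p}"
    and fp: "bij_betw f ({m c..l c} - {p}) (alive I c)"
    using label_step_missing[OF I False f] by blast
  define h where "h i = (if i \<le> p then i - 1 else i)" for i
  have h: "bij_betw h (rows c) ({m c..l c} - {p})"
    by (rule bij_betwI[where g = "\<lambda>i. if i < p then i + 1 else i"])
      (use p in \<open>auto simp: h_def rows_def\<close>)
  have bij: "bij_betw (f \<circ> h) (rows c) (alive I c)"
    using h fp by (rule bij_betw_trans)
  have hr: "h i \<in> rows (c + 1)" if "i \<in> rows c" for i
    using h that rows by (metis Diff_iff bij_betwE)
  have "i' = h i" if "i \<in> rows c" "i' \<in> rows (c + 1)" "f (h i) = f i'" for i i'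
    using f that hr by (metis bij_betw_imp_inj_on inj_onD)
  moreover have "h i = i \<or> h i = i - 1" for i by (simp add: h_def)
  ultimately have G: "label_step q I c f (f \<circ> h)"
    using bij False unfolding label_step_def comp_apply by blast
  have "g i = (f \<circ> h) i" if g: "label_step q I c f g" and i: "i \<in> rows c" for g i
  proof -
    have bg: "bij_betw g (rows c) (alive I c)" using g by (simp add: label_step_def)
    \<comment> \<open>For an arbitrary solution g, k is the row from which row i takes its label;
      the aim is k = h.\<close>
    have "\<exists>k\<in>{m c..l c} - {p}. f k = g i" if "i \<in> rows c" for i
      using bg fp that by (metis bij_betwE bij_betw_imp_surj_on imageE)
    then obtain k where k: "\<And>i. i \<in> rows c \<Longrightarrow> k i \<in> {m c..l c} - {p}" "\<And>i. i \<in> rows c \<Longrightarrow> f (k i) = g i"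
      by metis
    have "inj_on k (rows c)" using bg k by (metis bij_betw_imp_inj_on inj_on_def)
    moreover have "k i = i \<or> k i = i - 1" if "i \<in> rows c" for i
    proof -
      have "k i \<in> rows (c + 1)" using k(1)[OF that] rows by blast
      moreover have "g i = f (k i)" using k(2)[OF that] by simp
      ultimately show ?thesis using g that unfolding label_step_def by blast
    qed
    ultimately have "k i = h i"
      unfolding h_def using inj_shift_below[of k "m c" "l c" p i] k(1) p i
      by (auto simp: rows_def)
    then show ?thesis using k(2)[OF i] by simp
  qed
  with G show ?thesis by blast
qed

section \<open>Existence and uniqueness of labellings\<close>

lemma labelling_exists:
  assumes I: "pairing I" and q: "\<And>c. right c \<Longrightarrow> q c \<in> rows c"
  shows "\<exists>t. labelling q I t"
proof -
  have "\<exists>t. \<forall>c \<ge> K - int n. label_step q I c (t (c + 1)) (t c)" for n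
  proof (induction n)
    case 0
    then show ?case using label_step_outside[OF I] by auto
  next
    case (Suc n)
    then obtain t where t: "\<And>c. c \<ge> K - int n \<Longrightarrow> label_step q I c (t (c + 1)) (t c)" by blast
    define c where "c = K - int (Suc n)"
    have "bij_betw (t (c + 1)) (rows (c + 1)) (alive I (c + 1))"
      using t[of "c + 1"] by (simp add: c_def label_step_def)
    then obtain G where "label_step q I c (t (c + 1)) G"
      using label_step_unique_existence[OF I, of "t (c + 1)" c q] q by blast
    then have "label_step q I c' ((t(c := G)) (c' + 1)) ((t(c := G)) c')" if "c' \<ge> c" for c'
      using t[of c'] that by (cases "c' = c") (auto simp: c_def)
    then show ?case unfolding c_def by blast
  qed
  \<comment> \<open>This bound is at most \<open>- \<bar>K\<bar>\<close>, so every diagonal below it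
    is empty and the step condition holds trivially.\<close>
  then obtain t where t: "\<forall>c \<ge> K - int (nat (2 * \<bar>K\<bar>)). label_step q I c (t (c + 1)) (t c)" by blast
  have "label_step q I c (t (c + 1)) (t c)" for c
    using t label_step_outside[OF I, of c] by (cases "c \<ge> K - 2 * \<bar>K\<bar>") auto
  then show ?thesis by (auto simp: labelling_def)
qed

lemma labelling_unique:
  assumes I: "pairing I" and q: "\<And>c. right c \<Longrightarrow> q c \<in> rows c"
    and t: "labelling q I t" and t': "labelling q I t'" and i: "i \<in> rows c"
  shows "t c i = t' c i"
proof -
  have "\<forall>c \<ge> K - int n. \<forall>i\<in>rows c. t c i = t' c i" for n
  proof (induction n)
    case 0
    then show ?case using rows_outside by auto
  next
    case (Suc n)
    define c where "c = K - int (Suc n)"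
    have eq: "\<forall>i\<in>rows (c + 1). t (c + 1) i = t' (c + 1) i" using Suc by (simp add: c_def)
    have s: "label_step q I c (t (c + 1)) (t c)" and s1: "label_step q I (c + 1) (t (c + 1 + 1)) (t (c + 1))"
      and s': "label_step q I c (t' (c + 1)) (t' c)"
      using t t' unfolding labelling_def by blast+
    \<comment> \<open>The induction gives agreement only on rows of the shape, so
      \<open>label_step\<close> must be seen to read its argument there alone; this concerns the
      partners at a right snake.\<close>
    have sub: "j - 1 \<in> rows (c + 1)" if "j \<in> rows c" "right c" "q c < j" for j
      using that q[of c] by (auto simp: rows_def right_def)
    have sub': "j \<in> rows (c + 1)" if "j \<in> rows c" "right c" "j < q c" for j
      using that q[of c] by (auto simp: rows_def right_def)
    have "label_step q I c (t (c + 1)) (t' c)"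
      using s' eq sub sub' unfolding label_step_def by auto
    moreover have "bij_betw (t (c + 1)) (rows (c + 1)) (alive I (c + 1))"
      using s1 by (simp add: label_step_def)
    ultimately have "\<forall>i\<in>rows c. t c i = t' c i"
      using s label_step_unique_existence[OF I, of "t (c + 1)" c q] q by metis
    moreover have "c' = c \<or> c' \<ge> K - int n" if "c' \<ge> K - int (Suc n)" for c'
      using that by (auto simp: c_def)
    ultimately show ?case using Suc by metis
  qed
  from this[of "nat (K - c)"] i show ?thesis by auto
qed

end

section \<open>Minimal decompositions and pairings of snakes\<close>

text \<open>The shift by one gives the index of the snake on the contents Min - 1 and Min, where the
  strip starts; the size is then end minus start.\<close>

definition strip_start :: "square set \<Rightarrow> int" where
  "strip_start B = Min (content ` B) - 1"

definition strip_end :: "square set \<Rightarrow> int" where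
  "strip_end B = Max (content ` B)"

definition strip_ends :: "square set \<Rightarrow> int \<times> int" where
  "strip_ends B = (strip_start B, strip_end B)"

lemma ribbon_contents: "ribbon B \<Longrightarrow> content ` B = {strip_start B + 1..strip_end B}"
  using ribbon_content_image by (simp add: strip_start_def strip_end_def)

lemma ribbon_start_less_end:
  assumes "ribbon B"
  shows "strip_start B < strip_end B"
proof -
  have "content ` B \<noteq> {}" using assms by (simp add: ribbon_def)
  then show ?thesis using ribbon_contents[OF assms] by auto
qed

lemma ribbon_contentD:
  "ribbon B \<Longrightarrow> x \<in> B \<Longrightarrow> strip_start B < content x \<and> content x \<le> strip_end B"
  using ribbon_contents[of B] by force

lemma ribbon_ex_content:
  assumes "ribbon B" "strip_start B < c" "c \<le> strip_end B"
  obtains x where "x \<in> B" "content x = c"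
  using ribbon_contents[OF assms(1)] assms(2,3) by (metis add1_zle_eq atLeastAtMost_iff imageE)

lemma ribbon_adjacent:
  assumes "ribbon B" "x \<in> B" "y \<in> B" "content y = content x + 1"
  shows "share_edge x y"
proof -
  obtain z where "z \<in> B" "content z = content x + 1" "share_edge x z"
    using assms by (force simp: ribbon_def)
  then show ?thesis using assms by (metis inj_onD ribbon_def)
qed

lemma strip_ends_eqI:
  assumes "content ` B = {u + 1..v}" "u < v"
  shows "strip_ends B = (u, v)"
proof -
  have "Min {u + 1..v} = u + 1" "Max {u + 1..v} = v"
    using assms(2) by (auto intro!: Min_eqI Max_eqI)
  then show ?thesis by (simp add: strip_ends_def strip_start_def strip_end_def assms(1))
qed

context content_profile
begin

definition decomposition :: "square set set \<Rightarrow> bool" where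
  "decomposition D \<longleftrightarrow> partition_on squares D \<and> (\<forall>B\<in>D. ribbon B)"

text \<open>The condition of using all of \<open>F\<close>, once \<open>right_snake_matching\<close>
  has described \<open>F\<close> on each right snake by the single row \<open>q c\<close> that it
  misses.\<close>

definition linked :: "(int \<Rightarrow> int) \<Rightarrow> square set set \<Rightarrow> bool" where
  "linked q D \<longleftrightarrow> (\<forall>c. right c \<longrightarrow> (\<forall>i\<in>rows c.
     (i < q c \<longrightarrow> uses_link D {sq c i, sq (c + 1) i}) \<and>
     (q c < i \<longrightarrow> uses_link D {sq c i, sq (c + 1) (i - 1)})))"

definition label_class :: "(int \<Rightarrow> int \<Rightarrow> int) \<Rightarrow> int \<Rightarrow> square set" where
  "label_class t v = {x \<in> squares. t (content x) (fst x) = v}"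

section \<open>The lower bound for the number of strips\<close>

lemma bs_decomposition_iff: "bs_decomposition squares D \<longleftrightarrow> decomposition D"
proof -
  have "border_strip B \<longleftrightarrow> ribbon B" if "B \<subseteq> squares" for B
    using border_strip_ribbon ribbon_border_strip squares_pos that by blast
  then show ?thesis
    unfolding bs_decomposition_def decomposition_def by (metis Sup_upper partition_onD1)
qed

lemma decomposition_finite: "decomposition D \<Longrightarrow> finite D"
  using finite_squares by (auto simp: decomposition_def dest: finite_elements)

lemma decomposition_subset: "decomposition D \<Longrightarrow> B \<in> D \<Longrightarrow> x \<in> B \<Longrightarrow> x \<in> squares"
  by (auto simp: decomposition_def partition_on_def)

lemma decomposition_ribbon: "decomposition D \<Longrightarrow> B \<in> D \<Longrightarrow> ribbon B"
  by (auto simp: decomposition_def)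

lemma decomposition_ex: "decomposition D \<Longrightarrow> x \<in> squares \<Longrightarrow> \<exists>B\<in>D. x \<in> B"
  by (auto simp: decomposition_def partition_on_def)

lemma decomposition_unique:
  "decomposition D \<Longrightarrow> B \<in> D \<Longrightarrow> B' \<in> D \<Longrightarrow> x \<in> B \<Longrightarrow> x \<in> B' \<Longrightarrow> B = B'"
  by (auto simp: decomposition_def partition_on_def disjoint_def)

text \<open>Sending a square of content c to the square of content c' in its strip is injective, as
  a strip has at most one square of each content. Hence a strip must end where the diagonals get
  shorter and start where they get longer.\<close>

lemma decomposition_card_diagonal_le:
  assumes D: "decomposition D"
    and meet: "\<And>B. B \<in> D \<Longrightarrow> c \<in> content ` B \<Longrightarrow> c' \<in> content ` B"
  shows "l c - m c \<le> l c' - m c'"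
proof -
  have "\<exists>y. content y = c' \<and> (\<exists>B\<in>D. x \<in> B \<and> y \<in> B)" if "x \<in> squares" "content x = c" for x
    using decomposition_ex[OF D that(1)] meet that(2) by (metis imageE imageI)
  then obtain f where f: "\<And>x. x \<in> squares \<Longrightarrow> content x = c \<Longrightarrow>
      content (f x) = c' \<and> (\<exists>B\<in>D. x \<in> B \<and> f x \<in> B)"
    by metis
  have "card {x \<in> squares. content x = c} \<le> card {x \<in> squares. content x = c'}"
  proof (rule card_inj_on_le)
    show "inj_on f {x \<in> squares. content x = c}"
    proof (rule inj_onI)
      fix x y assume x: "x \<in> {x \<in> squares. content x = c}" and y: "y \<in> {x \<in> squares. content x = c}"
        and eq: "f x = f y"
      obtain B where B: "B \<in> D" "x \<in> B" "f x \<in> B" using f x by blast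
      obtain B' where B': "B' \<in> D" "y \<in> B'" "f y \<in> B'" using f y by blast
      have "B = B'" using B B' eq decomposition_unique[OF D] by metis
      then show "x = y"
        using B B' x y decomposition_ribbon[OF D B(1)] by (auto simp: ribbon_def inj_on_def)
    qed
    show "f ` {x \<in> squares. content x = c} \<subseteq> {x \<in> squares. content x = c'}"
      using f decomposition_subset[OF D] by blast
  qed (rule finite_diagonal)
  then have "int (card {x \<in> squares. content x = c}) \<le> int (card {x \<in> squares. content x = c'})"
    by (rule of_nat_mono)
  then show ?thesis by (simp only: card_diagonal)
qed

lemma right_is_strip_end:
  assumes D: "decomposition D" and v: "right v"
  shows "v \<in> strip_end ` D"
proof (rule ccontr)
  assume no: "v \<notin> strip_end ` D"
  have "v + 1 \<in> content ` B" if "B \<in> D" "v \<in> content ` B" for B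
  proof -
    note rib = decomposition_ribbon[OF D that(1)]
    have "strip_end B \<noteq> v" using no that(1) by blast
    then show ?thesis using that(2) unfolding ribbon_contents[OF rib] by auto
  qed
  then have "l v - m v \<le> l (v + 1) - m (v + 1)"
    using D by (rule decomposition_card_diagonal_le[rotated])
  then show False using v by (simp add: right_def)
qed

lemma left_is_strip_start:
  assumes D: "decomposition D" and u: "left u"
  shows "u \<in> strip_start ` D"
proof (rule ccontr)
  assume no: "u \<notin> strip_start ` D"
  have "u \<in> content ` B" if "B \<in> D" "u + 1 \<in> content ` B" for B
  proof -
    note rib = decomposition_ribbon[OF D that(1)]
    have "strip_start B \<noteq> u" using no that(1) by blast
    then show ?thesis using that(2) unfolding ribbon_contents[OF rib] by auto
  qed
  then have "l (u + 1) - m (u + 1) \<le> l u - m u"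
    using D by (rule decomposition_card_diagonal_le[rotated])
  then show False using u by (simp add: left_def)
qed

lemma decomposition_card_ge: "decomposition D \<Longrightarrow> card {k. left k} \<le> card D"
  using left_is_strip_start decomposition_finite by (intro surj_card_le) auto

text \<open>At the lower bound there is no room for further starts or ends: each left index starts
  one strip and each right index ends one. So the end alone identifies a strip and can serve as its
  label.\<close>

lemma strip_ends_pairing:
  assumes D: "decomposition D" and card: "card D = card {k. left k}"
  shows "pairing (strip_ends ` D)" and "inj_on strip_end D" and "inj_on strip_ends D"
proof -
  note fin = decomposition_finite[OF D]
  have s: "strip_start ` D = {k. left k}"
    by (rule card_seteq[symmetric])
      (use left_is_strip_start[OF D] fin card card_image_le[OF fin] in auto)
  have e: "strip_end ` D = {k. right k}"
    by (rule card_seteq[symmetric])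
      (use right_is_strip_end[OF D] fin card card_image_le[OF fin] card_left_eq_card_right in auto)
  have inj_start: "inj_on strip_start D"
    by (rule eq_card_imp_inj_on[OF fin]) (simp add: s card)
  have inj: "inj_on strip_end D"
    by (rule eq_card_imp_inj_on[OF fin]) (simp add: e card card_left_eq_card_right)
  show "pairing (strip_ends ` D)"
    unfolding pairing_def
  proof (intro conjI)
    show "fst ` strip_ends ` D = {k. left k}" "snd ` strip_ends ` D = {k. right k}"
      by (simp_all add: image_image strip_ends_def flip: s e)
    show "inj_on fst (strip_ends ` D)"
      using inj_start by (intro inj_on_imageI) (simp add: comp_def strip_ends_def)
    show "inj_on snd (strip_ends ` D)"
      using inj by (intro inj_on_imageI) (simp add: comp_def strip_ends_def)
    show "\<forall>(u, v)\<in>strip_ends ` D. u < v"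
      using ribbon_start_less_end[OF decomposition_ribbon[OF D]] by (auto simp: strip_ends_def)
  qed
  show "inj_on strip_end D" by (rule inj)
  then show "inj_on strip_ends D" by (auto simp: inj_on_def strip_ends_def)
qed

text \<open>Injectivity of \<open>strip_end\<close> recovers each strip as a label class. Squares of
  consecutive contents in one strip share an edge, which is the adjacency clause of
  \<open>label_step\<close>.\<close>

lemma decomposition_labelling:
  assumes D: "decomposition D" and card: "card D = card {k. left k}" and F: "linked q D"
  shows "\<exists>t. labelling q (strip_ends ` D) t \<and> D = label_class t ` snd ` strip_ends ` D"
proof -
  note inj = strip_ends_pairing(2)[OF D card]
  define blk where "blk x = (THE B. B \<in> D \<and> x \<in> B)" for x
  have blk: "blk x = B" if "B \<in> D" "x \<in> B" for x B
    unfolding blk_def by (rule the_equality) (use that decomposition_unique[OF D] in blast)+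
  have blk_in: "blk x \<in> D" "x \<in> blk x" if "x \<in> squares" for x
    using decomposition_ex[OF D that] blk by metis+
  define t where "t c i = strip_end (blk (sq c i))" for c i
  have same: "blk x = blk y" if "x \<in> squares" "y \<in> squares" "strip_end (blk x) = strip_end (blk y)" for x y
    using inj_onD[OF inj that(3)] blk_in that by blast
  have "label_step q (strip_ends ` D) c (t (c + 1)) (t c)" for c
    unfolding label_step_def
  proof (intro conjI ballI impI)
    show "bij_betw (t c) (rows c) (alive (strip_ends ` D) c)"
      unfolding bij_betw_def
    proof
      show "inj_on (t c) (rows c)"
      proof (rule inj_onI)
        fix i j assume ij: "i \<in> rows c" "j \<in> rows c" "t c i = t c j"
        then have "blk (sq c i) = blk (sq c j)" using same by (simp add: t_def)
        then have "sq c j \<in> blk (sq c i)" using blk_in[of "sq c j"] ij by simp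
        then have "sq c i = sq c j"
          using decomposition_ribbon[OF D] blk_in[of "sq c i"] ij
          by (intro inj_onD[of content "blk (sq c i)"]) (auto simp: ribbon_def)
        then show "i = j" by (metis fst_sq)
      qed
      show "t c ` rows c = alive (strip_ends ` D) c"
      proof
        show "t c ` rows c \<subseteq> alive (strip_ends ` D) c"
        proof
          fix v assume "v \<in> t c ` rows c"
          then obtain i where i: "i \<in> rows c" "v = strip_end (blk (sq c i))" by (auto simp: t_def)
          then have B: "blk (sq c i) \<in> D" "sq c i \<in> blk (sq c i)" using blk_in[of "sq c i"] by auto
          have "strip_start (blk (sq c i)) < c \<and> c \<le> v"
            using ribbon_contentD[OF decomposition_ribbon[OF D B(1)] B(2)] i by simp
          moreover have "(strip_start (blk (sq c i)), v) \<in> strip_ends ` D"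
            using B(1) i by (auto simp: strip_ends_def)
          ultimately show "v \<in> alive (strip_ends ` D) c" unfolding alive_def by blast
        qed
        show "alive (strip_ends ` D) c \<subseteq> t c ` rows c"
        proof
          fix v assume "v \<in> alive (strip_ends ` D) c"
          then obtain B where B: "B \<in> D" "strip_start B < c" "c \<le> strip_end B" "v = strip_end B"
            by (auto simp: alive_def strip_ends_def)
          then obtain x where x: "x \<in> B" "content x = c"
            using ribbon_ex_content decomposition_ribbon[OF D] by metis
          then have "fst x \<in> rows c" using fst_rows decomposition_subset[OF D B(1)] by blast
          moreover have "t c (fst x) = v"
            using x B blk[OF B(1) x(1)] sq_collapse[of x] by (simp add: t_def)
          ultimately show "v \<in> t c ` rows c" by blast
        qed
      qed
    qed
    show "i' = i \<or> i' = i - 1" if "i \<in> rows c" "i' \<in> rows (c + 1)" "t c i = t (c + 1) i'" for i i'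
    proof -
      have "blk (sq c i) = blk (sq (c + 1) i')" using same that by (simp add: t_def)
      then have "share_edge (sq c i) (sq (c + 1) i')"
        using blk_in[of "sq c i"] blk_in[of "sq (c + 1) i'"] that
        by (intro ribbon_adjacent[OF decomposition_ribbon[OF D]]) auto
      then show ?thesis by (simp add: share_edge_sq)
    qed
    have blk_link: "blk x = blk y" if "uses_link D {x, y}" for x y
      using that blk unfolding uses_link_def by (metis insert_subset)
    show "t c i = t (c + 1) i" if "right c" "i \<in> rows c" "i < q c" for i
      using F that blk_link[of "sq c i" "sq (c + 1) i"] by (simp add: linked_def t_def)
    show "t c i = t (c + 1) (i - 1)" if "right c" "i \<in> rows c" "q c < i" for i
      using F that blk_link[of "sq c i" "sq (c + 1) (i - 1)"] by (simp add: linked_def t_def)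
  qed
  moreover have "label_class t (strip_end B) = B" if B: "B \<in> D" for B
  proof
    show "label_class t (strip_end B) \<subseteq> B"
    proof
      fix x assume "x \<in> label_class t (strip_end B)"
      then have x: "x \<in> squares" "strip_end (blk x) = strip_end B" by (auto simp: label_class_def t_def)
      then have "blk x = B" using inj_onD[OF inj x(2)] blk_in B by blast
      then show "x \<in> B" using blk_in[OF x(1)] by simp
    qed
    show "B \<subseteq> label_class t (strip_end B)"
      using blk[OF B] decomposition_subset[OF D B] by (auto simp: label_class_def t_def)
  qed
  then have "D = label_class t ` snd ` strip_ends ` D" by (force simp: strip_ends_def image_image)
  ultimately show ?thesis by (auto simp: labelling_def)
qed

text \<open>For (u, v) in \<open>I\<close> the label v is alive exactly on the contents u + 1, ...,
  v, so its class has one square of each of them; the adjacency clause makes the class a ribbon with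
  the ends (u, v).\<close>

lemma label_class_decomposition:
  assumes I: "pairing I" and t: "labelling q I t" and q: "\<And>c. right c \<Longrightarrow> q c \<in> rows c"
  defines "D \<equiv> label_class t ` snd ` I"
  shows "decomposition D" and "strip_ends ` D = I" and "card D = card {k. left k}" and "linked q D"
proof -
  have step: "label_step q I c (t (c + 1)) (t c)" for c
    using t by (simp add: labelling_def)
  have bij: "bij_betw (t c) (rows c) (alive I c)" for c
    using step by (simp add: label_step_def)
  have mem: "sq c i \<in> label_class t v \<longleftrightarrow> i \<in> rows c \<and> t c i = v" for c i v
    by (simp add: label_class_def)
  have ex: "\<exists>i. sq c i \<in> label_class t v" if "v \<in> alive I c" for c v
    using bij[of c] that mem by (metis bij_betw_imp_surj_on imageE)
  have al: "v \<in> alive I (content x)" if "x \<in> label_class t v" for x v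
    using bij[of "content x"] that fst_rows[of x] by (auto simp: label_class_def bij_betw_def)
  have alI: "v \<in> alive I c \<longleftrightarrow> u < c \<and> c \<le> v" if "(u, v) \<in> I" for u v c
    using that pairing_unique_left[OF I] by (auto simp: alive_def)
  have contents: "content ` label_class t v = {u + 1..v}" if uv: "(u, v) \<in> I" for u v
  proof
    show "content ` label_class t v \<subseteq> {u + 1..v}"
      using al alI[OF that] by (metis add1_zle_eq atLeastAtMost_iff image_subsetI)
    show "{u + 1..v} \<subseteq> content ` label_class t v"
    proof
      fix c assume "c \<in> {u + 1..v}"
      then obtain i where "sq c i \<in> label_class t v" using ex[of v c] alI[OF uv] by auto
      then show "c \<in> content ` label_class t v" by (metis content_sq imageI)
    qed
  qed
  have ends: "strip_ends (label_class t v) = (u, v)" if "(u, v) \<in> I" for u v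
    using strip_ends_eqI[OF contents[OF that]] pairing_less[OF I that] by blast
  have ribbon: "ribbon (label_class t v)" if uv: "(u, v) \<in> I" for u v
    unfolding ribbon_def
  proof (intro conjI ballI impI)
    show "finite (label_class t v)" using finite_squares by (simp add: label_class_def)
    show "label_class t v \<noteq> {}" using contents[OF uv] pairing_less[OF I uv] by force
    show "inj_on content (label_class t v)"
    proof (rule inj_onI)
      fix x y assume xy: "x \<in> label_class t v" "y \<in> label_class t v" "content x = content y"
      then have "fst x = fst y"
        using bij[of "content x"] fst_rows[of x] fst_rows[of y]
        by (auto simp: label_class_def bij_betw_def inj_on_def)
      then show "x = y" using xy(3) sq_collapse by metis
    qed
    fix x y assume xy: "x \<in> label_class t v" "y \<in> label_class t v" "content x < content y"
    have "v \<in> alive I (content x + 1)"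
      using alI[OF uv] al[OF xy(1)] al[OF xy(2)] xy(3) by auto
    then obtain i where i: "sq (content x + 1) i \<in> label_class t v" using ex by blast
    have "sq (content x) (fst x) \<in> label_class t v" using xy(1) by simp
    then have "i = fst x \<or> i = fst x - 1"
      using step[of "content x"] i unfolding mem label_step_def by metis
    then have "share_edge x (sq (content x + 1) i)"
      using share_edge_sq[of "content x" "fst x" i] by simp
    then show "\<exists>z\<in>label_class t v. content z = content x + 1 \<and> share_edge x z"
      using i by (auto intro!: bexI[of _ "sq (content x + 1) i"])
  qed
  have cover: "\<exists>u v. (u, v) \<in> I \<and> x \<in> label_class t v" if x: "x \<in> squares" for x
  proof -
    have "t (content x) (fst x) \<in> alive I (content x)"
      using bij[of "content x"] fst_rows[OF x] by (auto simp: bij_betw_def)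
    then show ?thesis using x by (auto simp: alive_def label_class_def)
  qed
  show "decomposition D"
    unfolding decomposition_def D_def
  proof (rule conjI[OF partition_onI])
    show "\<Union> (label_class t ` snd ` I) = squares"
      using cover by (force simp: label_class_def)
    show "{} \<notin> label_class t ` snd ` I" using ribbon by (force simp: ribbon_def)
    show "disjnt p p'" if "p \<in> label_class t ` snd ` I" "p' \<in> label_class t ` snd ` I" "p \<noteq> p'" for p p'
      using that by (auto simp: label_class_def disjnt_def)
    show "\<forall>B\<in>label_class t ` snd ` I. ribbon B" using ribbon by force
  qed
  have "(\<lambda>p. strip_ends (label_class t (snd p))) ` I = (\<lambda>p. p) ` I"
    by (rule image_cong) (auto simp: ends)
  then show ends_I: "strip_ends ` D = I" by (simp add: D_def image_image)
  have "card I = card {k. left k}" using I by (metis card_image pairing_def)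
  moreover have "finite I"
    using I finite_left by (metis finite_imageD pairing_def)
  then have "card D \<le> card I" unfolding D_def image_image by (rule card_image_le)
  ultimately show "card D = card {k. left k}"
    using decomposition_card_ge[OF \<open>decomposition D\<close>] by simp
  have link: "uses_link D {sq c i, sq (c + 1) i'}"
    if ii: "i \<in> rows c" "i' \<in> rows (c + 1)" "t c i = t (c + 1) i'" for c i i'
  proof -
    obtain u v where "(u, v) \<in> I" "sq c i \<in> label_class t v" using cover[of "sq c i"] ii(1) by auto
    moreover from this have "sq (c + 1) i' \<in> label_class t v" using ii mem by simp
    ultimately show ?thesis by (force simp: uses_link_def D_def)
  qed
  show "linked q D"
    unfolding linked_def
  proof (intro allI impI ballI conjI)
    fix c i assume c: "right c" and i: "i \<in> rows c"
    show "uses_link D {sq c i, sq (c + 1) i}" if "i < q c"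
      using step[of c] c i that q[OF c] by (intro link) (auto simp: label_step_def rows_def right_def)
    show "uses_link D {sq c i, sq (c + 1) (i - 1)}" if "q c < i"
      using step[of c] c i that q[OF c] by (intro link) (auto simp: label_step_def rows_def right_def)
  qed
qed

text \<open>Matches brackets: the length of the diagonals increases by one at a left snake and
  decreases by one at a right snake, so this pairs each right snake with the left snake at which
  the current level was last reached.\<close>

lemma pairing_exists: "\<exists>I. pairing I"
proof -
  define d where "d c = l c - m c" for c
  have d0: "d c = 0" if "K \<le> \<bar>c\<bar>" for c using outside[OF that] by (simp add: d_def)
  have dpos: "0 \<le> d c" for c using le[of c] by (simp add: d_def)
  have dr: "d (v + 1) = d v - 1" if "right v" for v using that by (simp add: d_def right_def)
  have dl: "d (u + 1) = d u + 1" if "left u" for u using that by (simp add: d_def left_def)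
  have dleft: "left u" if "d u < d (u + 1)" for u
    using that l_step[of u] m_step[of u] by (auto simp: d_def left_def)
  define P where "P v u \<longleftrightarrow> u < v \<and> d u \<le> d (v + 1) \<and> (\<forall>c. u < c \<and> c \<le> v \<longrightarrow> d (v + 1) < d c)" for v u
  have ex: "\<exists>u. P v u" if v: "right v" for v
  proof -
    \<comment> \<open>The lower end lies before v and where \<open>d\<close> vanishes, so the set is
      not empty.\<close>
    let ?U = "{u \<in> {-\<bar>K\<bar>-\<bar>v\<bar>-1..<v}. d u \<le> d (v + 1)}"
    have "-\<bar>K\<bar>-\<bar>v\<bar>-1 \<in> ?U" using d0[of "-\<bar>K\<bar>-\<bar>v\<bar>-1"] dpos[of "v + 1"] by auto
    then have ne: "?U \<noteq> {}" by blast
    have fin: "finite ?U" by (rule finite_subset[of _ "{-\<bar>K\<bar>-\<bar>v\<bar>-1..<v}"]) auto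
    have M: "Max ?U \<in> ?U" using Max_in[OF fin ne] .
    have "d (v + 1) < d c" if c: "Max ?U < c" "c \<le> v" for c
    proof (rule ccontr)
      assume n: "\<not> d (v + 1) < d c"
      then have "c \<noteq> v" using dr[OF v] by auto
      then have "c \<in> ?U" using c M n by auto
      then show False using Max_ge[OF fin] c(1) by fastforce
    qed
    then have "P v (Max ?U)" using M by (simp add: P_def)
    then show ?thesis by blast
  qed
  then obtain f where f: "\<And>v. right v \<Longrightarrow> P v (f v)" by metis
  have val: "left (f v) \<and> d (f v) = d (v + 1)" if v: "right v" for v
  proof -
    have "d (v + 1) < d (f v + 1)" "d (f v) \<le> d (v + 1)" using f[OF v] by (auto simp: P_def)
    then show ?thesis using dleft[of "f v"] dl[of "f v"] by auto
  qed
  \<comment> \<open>From the common partner up to w the length stays strictly above its value after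
    w, yet v already brings it down to that value.\<close>
  have "False" if "right v" "right w" "f v = f w" "v < w" for v w
  proof -
    have "d (w + 1) < d (v + 1)" using f[OF that(1)] f[OF that(2)] that by (auto simp: P_def)
    then show False using val[OF that(1)] val[OF that(2)] that by simp
  qed
  then have inj: "inj_on f {k. right k}"
    by (intro inj_onI) (metis linorder_neqE mem_Collect_eq)
  have "f ` {k. right k} = {k. left k}"
    using inj val finite_left card_left_eq_card_right
    by (intro card_subset_eq) (auto simp: card_image)
  then have "pairing ((\<lambda>v. (f v, v)) ` {k. right k})"
    using f inj by (auto simp: pairing_def image_image inj_on_def P_def)
  then show ?thesis by blast
qed

text \<open>Minimality becomes a plain count once one decomposition attains the lower bound. The
  witness comes from an arbitrary pairing, with \<open>q = l\<close>: on each right snake the last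
  square of the longer diagonal is missed.\<close>

lemma minimal_iff:
  "minimal_bs_decomposition squares D \<longleftrightarrow> decomposition D \<and> card D = card {k. left k}"
proof -
  obtain I where I: "pairing I" using pairing_exists by blast
  have q: "right c \<Longrightarrow> l c \<in> rows c" for c using le[of "c + 1"] by (auto simp: rows_def right_def)
  obtain t where "labelling l I t" using labelling_exists[OF I] q by blast
  then have "\<exists>D. decomposition D \<and> card D = card {k. left k}"
    using label_class_decomposition[OF I _ q] by blast
  then show ?thesis
    unfolding minimal_bs_decomposition_def bs_decomposition_iff
    using decomposition_card_ge by (metis antisym)
qed

text \<open>Injective because the interval set determines the labelling on the shape and thereby its
  classes; onto because every pairing admits a labelling.\<close>

lemma strip_ends_bij:
  assumes q: "\<And>c. right c \<Longrightarrow> q c \<in> rows c"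
  shows "bij_betw ((`) strip_ends) {D. minimal_bs_decomposition squares D \<and> linked q D} {I. pairing I}"
proof (rule bij_betw_imageI)
  show "inj_on ((`) strip_ends) {D. minimal_bs_decomposition squares D \<and> linked q D}"
  proof (rule inj_onI)
    fix D D' assume "D \<in> {D. minimal_bs_decomposition squares D \<and> linked q D}"
      "D' \<in> {D. minimal_bs_decomposition squares D \<and> linked q D}"
      and eq: "strip_ends ` D = strip_ends ` D'"
    then have D: "decomposition D" "card D = card {k. left k}" "linked q D"
      and D': "decomposition D'" "card D' = card {k. left k}" "linked q D'"
      by (auto simp: minimal_iff)
    define I where "I = strip_ends ` D"
    have I: "pairing I" using strip_ends_pairing D by (simp add: I_def)
    obtain t where t: "labelling q I t" "D = label_class t ` snd ` I"
      using decomposition_labelling[OF D] unfolding I_def by blast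
    obtain t' where t': "labelling q I t'" "D' = label_class t' ` snd ` I"
      using decomposition_labelling[OF D'] unfolding I_def eq by blast
    have "label_class t v = label_class t' v" for v
      using labelling_unique[OF I q t(1) t'(1)] fst_rows by (auto simp: label_class_def)
    then show "D = D'" using t(2) t'(2) by simp
  qed
  show "(`) strip_ends ` {D. minimal_bs_decomposition squares D \<and> linked q D} = {I. pairing I}"
  proof
    show "(`) strip_ends ` {D. minimal_bs_decomposition squares D \<and> linked q D} \<subseteq> {I. pairing I}"
      using strip_ends_pairing by (auto simp: minimal_iff)
    show "{I. pairing I} \<subseteq> (`) strip_ends ` {D. minimal_bs_decomposition squares D \<and> linked q D}"
    proof
      fix I assume "I \<in> {I. pairing I}"
      then have I: "pairing I" by simp
      obtain t where t: "labelling q I t" using labelling_exists[OF I q] by blast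
      note D = label_class_decomposition[OF I t q]
      show "I \<in> (`) strip_ends ` {D. minimal_bs_decomposition squares D \<and> linked q D}"
        by (rule image_eqI[of _ _ "label_class t ` snd ` I"]) (use D in \<open>auto simp: minimal_iff\<close>)
    qed
  qed
qed

lemma bs_type_eq_interval_type:
  assumes "minimal_bs_decomposition squares D"
  shows "bs_type D = interval_type (strip_ends ` D)"
proof -
  have D: "decomposition D" "card D = card {k. left k}" using assms by (auto simp: minimal_iff)
  have "image_mset card (mset_set D) =
      image_mset ((\<lambda>(u, v). nat (v - u)) \<circ> strip_ends) (mset_set D)"
  proof (rule image_mset_cong)
    fix B assume "B \<in># mset_set D"
    then have "ribbon B" using decomposition_ribbon[OF D(1)] decomposition_finite[OF D(1)] by simp
    from ribbon_card[OF this] show "card B = ((\<lambda>(u, v). nat (v - u)) \<circ> strip_ends) B"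
      by (simp add: strip_ends_def strip_start_def strip_end_def)
  qed
  also have "\<dots> = image_mset (\<lambda>(u, v). nat (v - u)) (mset_set (strip_ends ` D))"
    using strip_ends_pairing(3)[OF D] by (simp flip: multiset.map_comp add: image_mset_mset_set)
  finally show ?thesis by (simp add: bs_type_def interval_type_def)
qed

end

section \<open>Snakes of partitions\<close>

context content_profile
begin

lemma pairing_iff:
  "pairing I \<longleftrightarrow> finite I \<and> int (card I) = rank squares \<and>
     card (fst ` I \<union> snd ` I) = 2 * card I \<and> (\<forall>(u, v)\<in>I. u < v \<and> left u \<and> right v)"
proof
  assume I: "pairing I"
  have fin: "finite I" using I finite_left by (metis finite_imageD pairing_def)
  have "card (fst ` I) = card I" "card (snd ` I) = card I"
    using I card_image[of fst I] card_image[of snd I] unfolding pairing_def by blast+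
  moreover have "fst ` I \<inter> snd ` I = {}" using I not_left_right by (auto simp: pairing_def)
  moreover have "card I = card {k. left k}" using I \<open>card (fst ` I) = card I\<close> by (simp add: pairing_def)
  ultimately show "finite I \<and> int (card I) = rank squares \<and>
     card (fst ` I \<union> snd ` I) = 2 * card I \<and> (\<forall>(u, v)\<in>I. u < v \<and> left u \<and> right v)"
    using fin pairing_left[OF I] pairing_right[OF I] pairing_less[OF I]
    by (auto simp: rank_squares card_Un_disjoint)
next
  assume *: "finite I \<and> int (card I) = rank squares \<and>
     card (fst ` I \<union> snd ` I) = 2 * card I \<and> (\<forall>(u, v)\<in>I. u < v \<and> left u \<and> right v)"
  then have card: "card I = card {k. left k}" and fin: "finite I" by (auto simp: rank_squares)
  have "card (fst ` I) = card I" "card (snd ` I) = card I"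
    using * card_Un_le[of "fst ` I" "snd ` I"] card_image_le[OF fin, of fst] card_image_le[OF fin, of snd]
    by auto
  moreover have "fst ` I \<subseteq> {k. left k}" "snd ` I \<subseteq> {k. right k}" using * by auto
  ultimately have "fst ` I = {k. left k}" "snd ` I = {k. right k}"
    using card card_left_eq_card_right
    by (simp_all add: card_subset_eq[OF finite_left] card_subset_eq[OF finite_right])
  moreover note \<open>card (fst ` I) = card I\<close> \<open>card (snd ` I) = card I\<close>
  ultimately show "pairing I"
    using * by (auto simp: pairing_def intro: eq_card_imp_inj_on)
qed

text \<open>The squares of content \<open>k\<close> and \<open>k + 1\<close> form a path with \<open>n\<close> and \<open>n - 1\<close> squares on the two
  diagonals, and a matching of size \<open>n - 1\<close> misses exactly one square of content \<open>k\<close>.\<close>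

lemma right_snake_matching:
  assumes k: "right k" and sub: "F \<subseteq> links {x \<in> squares. content x = k \<or> content x = k + 1}"
    and card: "int (card F) = l k - m k - 1"
    and cons: "\<And>L L'. L \<in> F \<Longrightarrow> L' \<in> F \<Longrightarrow> \<not> consecutive_links L L'"
  shows "\<exists>q\<in>rows k. F = {{sq k i, sq (k + 1) i} | i. i \<in> rows k \<and> i < q} \<union>
    {{sq k i, sq (k + 1) (i - 1)} | i. i \<in> rows k \<and> q < i}"
proof -
  have rk: "rows k = {m k<..l k}" "rows (k + 1) = {m k<..l k - 1}"
    using k by (auto simp: rows_def right_def)
  have ml: "m k < l k" using k le[of "k + 1"] by (simp add: right_def)
  have link: "\<exists>i\<in>rows k. \<exists>i'\<in>rows (k + 1). L = {sq k i, sq (k + 1) i'} \<and> (i' = i \<or> i' = i - 1)"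
    if L: "L \<in> F" for L
  proof -
    obtain a b where ab: "a \<in> squares" "b \<in> squares" "content a = k" "content b = k + 1"
      "share_edge a b" "L = {a, b}"
    proof -
      obtain x y where xy: "L = {x, y}" "x \<in> squares" "y \<in> squares" "share_edge x y"
        "content x = k \<or> content x = k + 1" "content y = k \<or> content y = k + 1"
        using subsetD[OF sub L] unfolding links_def by blast
      show thesis
      proof (cases "content x = k")
        case True
        then show thesis using xy share_edge_content[OF xy(4)] by (intro that[of x y]) auto
      next
        case False
        then show thesis
          using xy share_edge_content[OF xy(4)] share_edge_sym[of x y]
          by (intro that[of y x]) auto
      qed
    qed
    then have "a = sq k (fst a)" "b = sq (k + 1) (fst b)" using sq_collapse by metis+
    then show ?thesis
      using ab fst_rows[of a] fst_rows[of b] share_edge_sq[of k "fst a" "fst b"]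
      by (intro bexI[of _ "fst a"] bexI[of _ "fst b"]) auto
  qed
  have eqL: "L = L'" if "L \<in> F" "L' \<in> F" "x \<in> L" "x \<in> L'" for L L' x
    using cons[OF that(1,2)] that(3,4) by (auto simp: consecutive_links_def)
  have sq_ne: "sq k i \<noteq> sq (k + 1) i'" for i i' by (simp add: sq_def)
  have sq_inj: "sq c i = sq c i' \<longleftrightarrow> i = i'" for c i i' by (auto simp: sq_def)
  \<comment> \<open>Each link has one end on the shorter diagonal k + 1. These ends differ since the
    links are disjoint, and by their number they fill that diagonal.\<close>
  obtain g where g: "\<And>L. L \<in> F \<Longrightarrow> g L \<in> rows (k + 1) \<and> sq (k + 1) (g L) \<in> L"
    using link by (metis insertI1 insertI2)
  have "inj_on g F" using g eqL by (intro inj_onI) metis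
  moreover have "card F = card (rows (k + 1))" using card ml by (simp add: rk)
  ultimately have gF: "g ` F = rows (k + 1)"
    using g by (intro card_subset_eq) (auto simp: card_image)
  have "\<exists>i\<in>rows k. {sq k i, sq (k + 1) i'} \<in> F \<and> (i' = i \<or> i' = i - 1)"
    if i': "i' \<in> rows (k + 1)" for i'
  proof -
    have "i' \<in> g ` F" using i' by (simp add: gF)
    then obtain L where "L \<in> F" "i' = g L" by blast
    then have L: "L \<in> F" "sq (k + 1) i' \<in> L" using g by simp_all
    obtain i j where "i \<in> rows k" "j \<in> rows (k + 1)" "L = {sq k i, sq (k + 1) j}" "j = i \<or> j = i - 1"
      using link[OF L(1)] by blast
    moreover from this have "j = i'" using L(2) sq_ne sq_inj by (metis insertE singletonD)
    ultimately show ?thesis using L(1) by blast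
  qed
  then obtain h where h: "\<And>i'. i' \<in> rows (k + 1) \<Longrightarrow> h i' \<in> rows k"
      "\<And>i'. i' \<in> rows (k + 1) \<Longrightarrow> {sq k (h i'), sq (k + 1) i'} \<in> F"
      "\<And>i'. i' \<in> rows (k + 1) \<Longrightarrow> i' = h i' \<or> i' = h i' - 1"
    by metis
  have hinj: "inj_on h (rows (k + 1))"
  proof (rule inj_onI)
    fix i j assume ij: "i \<in> rows (k + 1)" "j \<in> rows (k + 1)" "h i = h j"
    then have "{sq k (h i), sq (k + 1) i} = {sq k (h j), sq (k + 1) j}"
      using eqL[OF h(2)[OF ij(1)] h(2)[OF ij(2)], of "sq k (h i)"] by simp
    then show "i = j" using sq_ne sq_inj by (metis doubleton_eq_iff)
  qed
  \<comment> \<open>The values of \<open>h i - 1\<close> are too few to fill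
    \<open>{m k..l k - 1}\<close>, so some p is missed and p + 1 is the unmatched row of content k.
    The shift by one gives \<open>inj_shift_below\<close> its form.\<close>
  have "card ((\<lambda>i. h i - 1) ` rows (k + 1)) \<le> card (rows (k + 1))"
    by (intro card_image_le) simp
  also have "\<dots> < card {m k..l k - 1}" using ml by (simp add: rk)
  finally have "\<not> {m k..l k - 1} \<subseteq> (\<lambda>i. h i - 1) ` rows (k + 1)"
    using card_mono[of "(\<lambda>i. h i - 1) ` rows (k + 1)" "{m k..l k - 1}"] by auto
  then obtain p where p: "p \<in> {m k..l k - 1}" "\<And>i. i \<in> rows (k + 1) \<Longrightarrow> h i - 1 \<noteq> p" by blast
  have "h i - 1 = (if i \<le> p then i - 1 else i)" if "i \<in> rows (k + 1)" for i
  proof (rule inj_shift_below[of "\<lambda>i. h i - 1" "m k" "l k - 1"])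
    show "inj_on (\<lambda>i. h i - 1) {m k<..l k - 1}" using hinj by (simp add: rk inj_on_def)
    show "h i - 1 = i \<or> h i - 1 = i - 1" if "i \<in> {m k<..l k - 1}" for i
      using h(3)[of i] that by (auto simp: rk)
    show "h i - 1 \<noteq> p" if "i \<in> {m k<..l k - 1}" for i using p(2)[of i] that by (simp add: rk)
    show "m k \<le> p" "p \<le> l k - 1" using p(1) by auto
    show "i \<in> {m k<..l k - 1}" using that by (simp add: rk)
  qed
  then have hp: "h i = (if i \<le> p then i else i + 1)" if "i \<in> rows (k + 1)" for i
    using that by (smt (verit))
  show ?thesis
  proof (intro bexI[of _ "p + 1"] subset_antisym subsetI)
    show "p + 1 \<in> rows k" using p(1) by (simp add: rk)
    fix L assume L: "L \<in> F"
    obtain i' where i': "i' \<in> rows (k + 1)" "sq (k + 1) i' \<in> L" using g[OF L] by blast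
    have Leq: "L = {sq k (h i'), sq (k + 1) i'}"
      using eqL[OF L h(2)[OF i'(1)] i'(2)] by simp
    show "L \<in> {{sq k i, sq (k + 1) i} | i. i \<in> rows k \<and> i < p + 1} \<union>
        {{sq k i, sq (k + 1) (i - 1)} | i. i \<in> rows k \<and> p + 1 < i}"
    proof (cases "i' \<le> p")
      case True
      then show ?thesis using Leq hp[OF i'(1)] h(1)[OF i'(1)] by auto
    next
      case False
      then have "h i' = i' + 1" using hp[OF i'(1)] by simp
      then show ?thesis using Leq False h(1)[OF i'(1)] by (intro UnI2 CollectI exI[of _ "i' + 1"]) auto
    qed
  next
    fix L assume "L \<in> {{sq k i, sq (k + 1) i} | i. i \<in> rows k \<and> i < p + 1} \<union>
        {{sq k i, sq (k + 1) (i - 1)} | i. i \<in> rows k \<and> p + 1 < i}"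
    then consider i where "L = {sq k i, sq (k + 1) i}" "i \<in> rows k" "i < p + 1"
      | i where "L = {sq k i, sq (k + 1) (i - 1)}" "i \<in> rows k" "p + 1 < i"
      by blast
    then show "L \<in> F"
    proof cases
      case 1
      then show ?thesis using h(2)[of i] hp[of i] p(1) by (auto simp: rk)
    next
      case 2
      then show ?thesis using h(2)[of "i - 1"] hp[of "i - 1"] p(1) by (auto simp: rk)
    qed
  qed
qed

end

section \<open>Staircases and row counts\<close>

lemma mem_left_staircase:
  "x \<in> left_staircase (i, j) \<longleftrightarrow> fst x \<le> i \<and> (content x = j - i \<or> content x = j - i - 1)"
proof
  show "x \<in> left_staircase (i, j) \<Longrightarrow> fst x \<le> i \<and> (content x = j - i \<or> content x = j - i - 1)"
    by (auto simp: left_staircase_def content_def)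
  assume *: "fst x \<le> i \<and> (content x = j - i \<or> content x = j - i - 1)"
  define p where "p = nat (i - fst x)"
  have "x = (i - int p, j - int p) \<or> x = (i - int p, j - int p - 1)"
    using * by (cases x) (auto simp: p_def content_def)
  then show "x \<in> left_staircase (i, j)" unfolding left_staircase_def by blast
qed

text \<open>The squares of the larger content start one row higher; this matches the drop of
  \<open>row_count\<close> at a vertical step.\<close>

lemma mem_up_staircase:
  "x \<in> up_staircase (i, j) \<longleftrightarrow>
     fst x \<le> i \<and> content x = j - i \<or> fst x \<le> i - 1 \<and> content x = j - i + 1"
proof
  show "x \<in> up_staircase (i, j) \<Longrightarrow>
      fst x \<le> i \<and> content x = j - i \<or> fst x \<le> i - 1 \<and> content x = j - i + 1"
    by (auto simp: up_staircase_def content_def)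
  assume "fst x \<le> i \<and> content x = j - i \<or> fst x \<le> i - 1 \<and> content x = j - i + 1"
  then have "\<exists>p::nat. x = (i - int p, j - int p) \<or> x = (i - int p - 1, j - int p)"
  proof (elim disjE)
    assume "fst x \<le> i \<and> content x = j - i"
    then show ?thesis
      by (intro exI[of _ "nat (i - fst x)"]) (cases x, auto simp: content_def)
  next
    assume "fst x \<le> i - 1 \<and> content x = j - i + 1"
    then show ?thesis
      by (intro exI[of _ "nat (i - 1 - fst x)"]) (cases x, auto simp: content_def)
  qed
  then show "x \<in> up_staircase (i, j)" unfolding up_staircase_def by blast
qed

text \<open>For negative \<open>c\<close> this also counts the first \<open>- c\<close> rows, where the position \<open>(i, i + c)\<close>
  lies to the left of the first column.\<close>

definition row_count :: "nat list \<Rightarrow> int \<Rightarrow> int" where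
  "row_count \<alpha> c = int (card {i. 1 \<le> i \<and> c \<le> part \<alpha> i - i})"

lemma row_count_nonneg: "0 \<le> row_count \<alpha> c"
  by (simp add: row_count_def)

lemma part_beyond: "int (length \<alpha>) < i \<Longrightarrow> part \<alpha> i = 0"
  by (simp add: part_def)

text \<open>Since part i - i decreases with i, the counted rows form an initial segment, and
  counting them amounts to naming the last one.\<close>

lemma le_row_count_iff:
  assumes \<alpha>: "is_partition \<alpha>" and i: "1 \<le> i"
  shows "i \<le> row_count \<alpha> c \<longleftrightarrow> c \<le> part \<alpha> i - i"
proof -
  let ?X = "{i. 1 \<le> i \<and> c \<le> part \<alpha> i - i}"
  have "?X \<subseteq> {1..int (length \<alpha>) + \<bar>c\<bar>}"
  proof
    fix i assume "i \<in> ?X"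
    then show "i \<in> {1..int (length \<alpha>) + \<bar>c\<bar>}"
      using part_beyond[of \<alpha> i] by (cases "int (length \<alpha>) < i") auto
  qed
  then have "finite ?X" by (rule finite_subset) simp
  then have "?X = {1..row_count \<alpha> c}"
    unfolding row_count_def
  proof (rule down_closed_int)
    fix i k assume "i \<in> ?X" "1 \<le> k" "k \<le> i"
    then show "k \<in> ?X" using part_antimono[OF \<alpha>, of k i] by auto
  qed simp
  then show ?thesis using i by (auto simp: set_eq_iff)
qed

lemma row_count_eqI:
  assumes \<alpha>: "is_partition \<alpha>" and n: "0 \<le> n" and "\<And>i. 1 \<le> i \<Longrightarrow> i \<le> n \<longleftrightarrow> c \<le> part \<alpha> i - i"
  shows "row_count \<alpha> c = n"
proof -
  have "i \<le> row_count \<alpha> c \<longleftrightarrow> i \<le> n" if "1 \<le> i" for i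
    using le_row_count_iff[OF \<alpha> that] assms(3)[OF that] by simp
  from this[of n] this[of "row_count \<alpha> c"] show ?thesis
    using n row_count_nonneg[of \<alpha> c] by linarith
qed

text \<open>As part i - i is strictly decreasing, at most one row has the value c exactly.\<close>

lemma row_count_step:
  assumes \<alpha>: "is_partition \<alpha>"
  shows "row_count \<alpha> (c + 1) = row_count \<alpha> c \<or> row_count \<alpha> (c + 1) = row_count \<alpha> c - 1"
proof -
  have "row_count \<alpha> (c + 1) \<le> row_count \<alpha> c"
    using le_row_count_iff[OF \<alpha>, of "row_count \<alpha> (c + 1)" "c + 1"]
      le_row_count_iff[OF \<alpha>, of "row_count \<alpha> (c + 1)" c] row_count_nonneg[of \<alpha> c]
    by (cases "1 \<le> row_count \<alpha> (c + 1)") auto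
  moreover have "row_count \<alpha> c - 1 \<le> row_count \<alpha> (c + 1)"
  proof (cases "2 \<le> row_count \<alpha> c")
    case True
    then show ?thesis
      using le_row_count_iff[OF \<alpha>, of "row_count \<alpha> c" c]
        le_row_count_iff[OF \<alpha>, of "row_count \<alpha> c - 1" "c + 1"]
        part_antimono[OF \<alpha>, of "row_count \<alpha> c - 1" "row_count \<alpha> c"]
      by auto
  next
    case False
    then show ?thesis using row_count_nonneg[of \<alpha> "c + 1"] by simp
  qed
  ultimately show ?thesis by linarith
qed

lemma row_count_mono:
  assumes "is_partition lam" "is_partition mu" "partition_contains lam mu"
  shows "row_count mu c \<le> row_count lam c"
proof (cases "1 \<le> row_count mu c")
  case True
  then have "c \<le> part mu (row_count mu c) - row_count mu c"
    using le_row_count_iff[OF assms(2)] by blast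
  also have "\<dots> \<le> part lam (row_count mu c) - row_count mu c"
    using assms(3) by (simp add: partition_contains_def)
  finally show ?thesis using le_row_count_iff[OF assms(1) True] by simp
next
  case False
  then show ?thesis using row_count_nonneg[of lam c] by simp
qed

lemma row_count_large:
  assumes \<alpha>: "is_partition \<alpha>" and c: "part \<alpha> 1 \<le> c"
  shows "row_count \<alpha> c = 0"
proof (rule row_count_eqI[OF \<alpha>])
  fix i :: int assume "1 \<le> i"
  then show "i \<le> 0 \<longleftrightarrow> c \<le> part \<alpha> i - i" using part_antimono[OF \<alpha>, of 1 i] c by auto
qed simp

text \<open>Rows of length 0 count as well, so far to the left the value is not 0; what matters is
  that it is the same for both partitions.\<close>

lemma row_count_small:
  assumes \<alpha>: "is_partition \<alpha>" and c: "c \<le> - int (length \<alpha>)"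
  shows "row_count \<alpha> c = - c"
proof (rule row_count_eqI[OF \<alpha>])
  fix i :: int assume "1 \<le> i"
  show "i \<le> - c \<longleftrightarrow> c \<le> part \<alpha> i - i"
    using part_nonneg[of \<alpha> i] part_beyond[of \<alpha> i] c by (cases "i \<le> - c") auto
qed (use c in simp)

lemma row_count_ge:
  assumes \<alpha>: "is_partition \<alpha>"
  shows "0 \<le> row_count \<alpha> c + c"
proof (cases "1 \<le> - c")
  case True
  then show ?thesis using le_row_count_iff[OF \<alpha>, of "- c" c] part_nonneg[of \<alpha> "- c"] by auto
qed (use row_count_nonneg[of \<alpha> c] in simp)

text \<open>Closed form of step k. The rows counted at k are those above its starting point, and the
  step is vertical exactly if the last of them has part i - i = k.\<close>

definition boundary_step :: "nat list \<Rightarrow> int \<Rightarrow> step" where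
  "boundary_step \<alpha> k = (if row_count \<alpha> (k + 1) = row_count \<alpha> k
     then HStep (k + row_count \<alpha> k) (- row_count \<alpha> k)
     else VStep (k + row_count \<alpha> k) (- row_count \<alpha> k))"

text \<open>This makes the definite description in \<open>path_step\<close> proper. Inequalities
  between parts are turned into inequalities for \<open>row_count\<close>, which moves by at most
  one.\<close>

lemma boundary_path_iff:
  assumes \<alpha>: "is_partition \<alpha>"
  shows "e \<in> boundary_path \<alpha> \<and> step_index e = k \<longleftrightarrow> e = boundary_step \<alpha> k"
proof (cases e)
  case (HStep x y)
  let ?r = "row_count \<alpha>"
  have A: "part \<alpha> (1 - y) \<le> k - y \<longleftrightarrow> ?r k \<le> - y" if "y \<le> 0"
    using le_row_count_iff[OF \<alpha>, of "1 - y" k] that by auto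
  have B: "k - y < part \<alpha> (- y) \<longleftrightarrow> - y \<le> ?r (k + 1)" if "y < 0"
    using le_row_count_iff[OF \<alpha>, of "- y" "k + 1"] that by auto
  have "e \<in> boundary_path \<alpha> \<and> step_index e = k \<longleftrightarrow>
      x = k - y \<and> y \<le> 0 \<and> part \<alpha> (1 - y) \<le> k - y \<and> (y < 0 \<longrightarrow> k - y < part \<alpha> (- y))"
    by (auto simp: HStep boundary_path_def)
  also have "\<dots> \<longleftrightarrow> x = k - y \<and> y \<le> 0 \<and> ?r k \<le> - y \<and> (y < 0 \<longrightarrow> - y \<le> ?r (k + 1))"
    using A B by blast
  also have "\<dots> \<longleftrightarrow> x = k + ?r k \<and> y = - ?r k \<and> ?r (k + 1) = ?r k"
    using row_count_step[OF \<alpha>, of k] row_count_nonneg[of \<alpha> k] row_count_nonneg[of \<alpha> "k + 1"]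
    by auto
  also have "\<dots> \<longleftrightarrow> e = boundary_step \<alpha> k" by (auto simp: HStep boundary_step_def)
  finally show ?thesis .
next
  case (VStep x y)
  let ?r = "row_count \<alpha>"
  have "e \<in> boundary_path \<alpha> \<and> step_index e = k \<longleftrightarrow> x = k - y \<and> y < 0 \<and> k = part \<alpha> (- y) + y"
    by (auto simp: VStep boundary_path_def)
  also have "\<dots> \<longleftrightarrow> x = k - y \<and> y < 0 \<and> - y \<le> ?r k \<and> \<not> - y \<le> ?r (k + 1)"
    using le_row_count_iff[OF \<alpha>, of "- y" "k"] le_row_count_iff[OF \<alpha>, of "- y" "k + 1"] by auto
  also have "\<dots> \<longleftrightarrow> x = k + ?r k \<and> y = - ?r k \<and> ?r (k + 1) \<noteq> ?r k"
    using row_count_step[OF \<alpha>, of k] row_count_nonneg[of \<alpha> k] row_count_nonneg[of \<alpha> "k + 1"]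
    by auto
  also have "\<dots> \<longleftrightarrow> e = boundary_step \<alpha> k" by (auto simp: VStep boundary_step_def)
  finally show ?thesis .
qed

lemma path_step_eq: "is_partition \<alpha> \<Longrightarrow> path_step \<alpha> k = boundary_step \<alpha> k"
  unfolding path_step_def boundary_path_iff by simp

section \<open>From partitions to profiles\<close>

locale skew_shape =
  fixes lam mu :: "nat list"
  assumes lam: "is_partition lam" and mu: "is_partition mu" and contains: "partition_contains lam mu"
begin

definition content_limit :: int where
  "content_limit = int (length lam) + int (length mu) + part lam 1 + part mu 1"

sublocale content_profile "row_count lam" "row_count mu" content_limit
proof
  fix c :: int
  show "row_count mu c \<le> row_count lam c" by (rule row_count_mono[OF lam mu contains])
  show "row_count lam (c + 1) = row_count lam c \<or> row_count lam (c + 1) = row_count lam c - 1"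
    by (rule row_count_step[OF lam])
  show "row_count mu (c + 1) = row_count mu c \<or> row_count mu (c + 1) = row_count mu c - 1"
    by (rule row_count_step[OF mu])
  show "0 \<le> row_count mu c" by (rule row_count_nonneg)
  show "0 \<le> row_count mu c + c" by (rule row_count_ge[OF mu])
  assume c: "content_limit \<le> \<bar>c\<bar>"
  have nn: "0 \<le> part lam 1" "0 \<le> part mu 1" by (rule part_nonneg)+
  show "row_count lam c = row_count mu c"
  proof (cases "0 \<le> c")
    case True
    then have "row_count lam c = 0" "row_count mu c = 0"
      using c nn by (intro row_count_large lam mu; simp add: content_limit_def)+
    then show ?thesis by simp
  next
    case False
    then have "row_count lam c = - c" "row_count mu c = - c"
      using c nn by (intro row_count_small lam mu; simp add: content_limit_def)+
    then show ?thesis by simp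
  qed
qed

lemma skew_eq_squares: "skew lam mu = squares"
proof -
  have "1 \<le> i \<and> part mu i < j \<and> j \<le> part lam i \<longleftrightarrow>
      row_count mu (j - i) < i \<and> i \<le> row_count lam (j - i)" for i j
    using le_row_count_iff[OF lam, of i "j - i"] le_row_count_iff[OF mu, of i "j - i"]
      row_count_nonneg[of mu "j - i"]
    by (cases "1 \<le> i") auto
  then show ?thesis by (simp add: skew_def squares_def)
qed

text \<open>The staircases only add bounds on the row that all squares of the shape satisfy. If the
  two paths share step k, the counts agree at k and k + 1, so both diagonals are empty.\<close>

lemma snake_eq: "snake lam mu k = {x \<in> squares. content x = k \<or> content x = k + 1}"
proof -
  let ?l = "row_count lam"
  have fst_le: "fst x \<le> ?l (content x)" if "x \<in> squares" for x
    using fst_rows[OF that] by (simp add: rows_def)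
  show ?thesis
  proof (cases "path_step lam k \<in> boundary_path mu")
    case True
    have "step_index (path_step lam k) = k"
      using boundary_path_iff[OF lam] path_step_eq[OF lam] by blast
    then have "boundary_step lam k = boundary_step mu k"
      using True boundary_path_iff[OF mu] path_step_eq[OF lam] by metis
    then have "?l k = row_count mu k" "?l (k + 1) = row_count mu (k + 1)"
      using l_step[of k] m_step[of k] by (auto simp: boundary_step_def split: if_splits)
    then have "rows k = {}" "rows (k + 1) = {}" by (auto simp: rows_def)
    then have "{x \<in> squares. content x = k \<or> content x = k + 1} = {}" by (auto dest: fst_rows)
    then show ?thesis using True by (simp add: snake_def)
  next
    case False
    show ?thesis
    proof (cases "?l (k + 1) = ?l k")
      case True
      then have "snake lam mu k = squares \<inter> left_staircase (?l k, k + ?l k + 1)"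
        using False by (simp add: snake_def path_step_eq[OF lam] boundary_step_def skew_eq_squares)
      moreover have "x \<in> squares \<inter> left_staircase (?l k, k + ?l k + 1) \<longleftrightarrow>
          x \<in> squares \<and> (content x = k \<or> content x = k + 1)" for x
        using fst_le[of x] True by (auto simp: mem_left_staircase)
      ultimately show ?thesis by blast
    next
      case n: False
      then have "snake lam mu k = squares \<inter> up_staircase (?l k, k + ?l k)"
        using False by (simp add: snake_def path_step_eq[OF lam] boundary_step_def skew_eq_squares)
      moreover have "x \<in> squares \<inter> up_staircase (?l k, k + ?l k) \<longleftrightarrow>
          x \<in> squares \<and> (content x = k \<or> content x = k + 1)" for x
        using fst_le[of x] n l_step[of k] by (auto simp: mem_up_staircase)
      ultimately show ?thesis by blast
    qed
  qed
qed

lemma snake_length_eq: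
  "snake_length lam mu k =
     row_count lam k - row_count mu k + (row_count lam (k + 1) - row_count mu (k + 1)) - 1"
proof -
  have eq: "snake lam mu k = {x \<in> squares. content x = k} \<union> {x \<in> squares. content x = k + 1}"
    unfolding snake_eq by blast
  have "{x \<in> squares. content x = k} \<inter> {x \<in> squares. content x = k + 1} = {}" by fastforce
  from card_Un_disjoint[OF finite_diagonal finite_diagonal this] show ?thesis
    by (simp add: snake_length_def eq card_diagonal)
qed

text \<open>At a horizontal step the two diagonals together have twice the length of the first, plus
  one exactly if step k of the path of mu is vertical; so parity decides.\<close>

lemma left_snake_iff: "left_snake lam mu k \<longleftrightarrow> left k"
proof -
  let ?d = "row_count lam k - row_count mu k"
  have "(\<exists>x y. path_step lam k = HStep x y) \<longleftrightarrow> row_count lam (k + 1) = row_count lam k"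
    by (simp add: path_step_eq[OF lam] boundary_step_def)
  moreover have "snake_length lam mu k = 2 * ?d \<longleftrightarrow> row_count mu (k + 1) = row_count mu k - 1"
    and "snake_length lam mu k = 2 * ?d - 1 \<longleftrightarrow> row_count mu (k + 1) = row_count mu k"
    if "row_count lam (k + 1) = row_count lam k"
    using that by (auto simp: snake_length_eq)
  ultimately show ?thesis
    using m_step[of k] le[of k] by (auto simp: left_snake_def left_def)
qed

lemma right_snake_iff: "right_snake lam mu k \<longleftrightarrow> right k"
proof -
  let ?d = "row_count lam k - row_count mu k"
  have "(\<exists>x y. path_step lam k = VStep x y) \<longleftrightarrow> row_count lam (k + 1) = row_count lam k - 1"
    using l_step[of k] by (auto simp: path_step_eq[OF lam] boundary_step_def)
  moreover have "snake_length lam mu k = 2 * (?d - 1) \<longleftrightarrow> row_count mu (k + 1) = row_count mu k"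
    and "snake_length lam mu k = 2 * ?d - 1 \<longleftrightarrow> row_count mu (k + 1) = row_count mu k - 1"
    if "row_count lam (k + 1) = row_count lam k - 1"
    using that by (auto simp: snake_length_eq)
  ultimately show ?thesis
    using m_step[of k] le[of "k + 1"] by (auto simp: right_snake_def right_def)
qed

end

theorem theorem4p10:
  fixes lam mu \<sigma> :: "nat list" and N :: nat and F :: "int \<Rightarrow> square set set"
  assumes "is_partition lam" and "is_partition mu" and "partition_contains lam mu"
    and "N = card (skew lam mu)"
    and "\<And>k. right_snake lam mu k \<Longrightarrow> F k \<subseteq> links (snake lam mu k)"
    and "\<And>k. right_snake lam mu k \<Longrightarrow> int (card (F k)) = snake_length lam mu k div 2"
    and "\<And>k L L'. right_snake lam mu k \<Longrightarrow> L \<in> F k \<Longrightarrow> L' \<in> F k \<Longrightarrow> \<not> consecutive_links L L'"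
    and "\<sigma> partitions N"
  shows "card {D \<in> minimal_bs_decompositions_using (skew lam mu)
                 (\<Union>k\<in>{k. right_snake lam mu k}. F k). bs_type D = \<sigma>}
         = num_interval_sets \<sigma> lam mu"
proof -
  interpret skew_shape lam mu using assms(1-3) by unfold_locales
  \<comment> \<open>A predicate for the conclusion of \<open>right_snake_matching\<close>, from
    which one row per right snake can be chosen.\<close>
  define missed where "missed k r \<longleftrightarrow> r \<in> rows k \<and>
    F k = {{sq k i, sq (k + 1) i} | i. i \<in> rows k \<and> i < r} \<union>
      {{sq k i, sq (k + 1) (i - 1)} | i. i \<in> rows k \<and> r < i}" for k r
  have "\<exists>r. missed k r" if k: "right k" for k
    unfolding missed_def
  proof (rule right_snake_matching[OF k, unfolded Bex_def])
    note rs = k[folded right_snake_iff]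
    show "F k \<subseteq> links {x \<in> squares. content x = k \<or> content x = k + 1}"
      using assms(5)[OF rs] by (simp add: snake_eq)
    \<comment> \<open>The length of the snake is twice the length of its shorter diagonal, so half
      of it is the size of a maximum matching.\<close>
    show "int (card (F k)) = row_count lam k - row_count mu k - 1"
      using assms(6)[OF rs] k by (simp add: snake_length_eq right_def)
    show "\<not> consecutive_links L L'" if "L \<in> F k" "L' \<in> F k" for L L'
      using assms(7)[OF rs] that by blast
  qed
  then obtain q where "\<And>k. right k \<Longrightarrow> missed k (q k)" by metis
  then have q: "\<And>k. right k \<Longrightarrow> q k \<in> rows k"
    and Fq: "\<And>k. right k \<Longrightarrow> F k = {{sq k i, sq (k + 1) i} | i. i \<in> rows k \<and> i < q k} \<union>
      {{sq k i, sq (k + 1) (i - 1)} | i. i \<in> rows k \<and> q k < i}"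
    unfolding missed_def by simp_all
  have linked_iff: "(\<forall>L\<in>(\<Union>k\<in>{k. right_snake lam mu k}. F k). uses_link D L) \<longleftrightarrow> linked q D" for D
  proof -
    have "(\<forall>L\<in>F k. uses_link D L) \<longleftrightarrow> (\<forall>i\<in>rows k.
        (i < q k \<longrightarrow> uses_link D {sq k i, sq (k + 1) i}) \<and>
        (q k < i \<longrightarrow> uses_link D {sq k i, sq (k + 1) (i - 1)}))" if "right k" for k
      unfolding Fq[OF that] by blast
    then show ?thesis by (auto simp: linked_def right_snake_iff)
  qed
  have "{D \<in> minimal_bs_decompositions_using (skew lam mu)
      (\<Union>k\<in>{k. right_snake lam mu k}. F k). bs_type D = \<sigma>} =
      {D \<in> {D. minimal_bs_decomposition squares D \<and> linked q D}. interval_type (strip_ends ` D) = \<sigma>}"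
    unfolding minimal_bs_decompositions_using_def linked_iff skew_eq_squares
    using bs_type_eq_interval_type by auto
  moreover have "{I. interval_set lam mu I \<and> interval_type I = \<sigma>} =
      {I \<in> {I. pairing I}. interval_type I = \<sigma>}"
    by (auto simp: interval_set_def pairing_iff skew_eq_squares left_snake_iff right_snake_iff)
  \<comment> \<open>Strip sizes are interval lengths, so the bijection restricts to each
    type.\<close>
  moreover have "bij_betw ((`) strip_ends)
      {D \<in> {D. minimal_bs_decomposition squares D \<and> linked q D}. interval_type (strip_ends ` D) = \<sigma>}
      {I \<in> {I. pairing I}. interval_type I = \<sigma>}"
    by (rule bij_betw_Collect[OF strip_ends_bij[OF q]]) auto
  ultimately show ?thesis
    unfolding num_interval_sets_def by (simp add: bij_betw_same_card)
qed

end
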